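(* Let $\mathbb{F}$ be a field of characteristic $2$. Let $\widetilde\Gamma$ be the lift of $\widetilde H_3(\mathbb{F})$ with respect to the voltage assignment $\ell^U$, and let $\Gamma=\widetilde\Gamma/\sim$ be its reduct. Then every connected component of $\Gamma$ is an $|\mathbb{F}^6|$-fold cover of $H_3(\mathbb{F})$.
   Context: All graphs are simple and undirected; $u\perp v$ denotes adjacency, and a dart is an ordered pair $(u,v)$ with $u\perp v$; $D(\Delta)$ is the set of darts of $\Delta$. A voltage assignment of a graph $\Delta$ in a group $N$ is a map $\ell:D(\Delta)\to N$ with $\ell(u,v)=\ell(v,u)^{-1}$; the lift of $\Delta$ with respect to $\ell$ is the graph with vertex set $V(\Delta)\times N$ in which $(u,m)\perp(v,n)$ iff $u\perp v$ and $\ell(u,v)=mn^{-1}$ (written $m-n$ when $N$ is abelian and written additively). The local graph at a vertex is the subgraph induced on its neighbourhood. A map $V(\Gamma)\to V(\Delta)$ preserving adjacency and mapping the local graph at every vertex isomorphically onto the local graph at its image is a local isomorphism; if $\Gamma,\Delta$ are connected and such a map exists, $\Gamma$ is a cover of $\Delta$, and it is a $k$-fold cover if the fibres have cardinality $k$. For a graph $\Gamma$, the relation $u\sim v\iff u^\perp=v^\perp$ (equal neighbourhoods) is an equivalence relation whose classes are cocliques; the reduct $\Gamma/\sim$ has the classes as vertices, with adjacency inherited from representatives. $H_3(\mathbb{F})$: vertices are pairs $(x,X)$ with $x$ a point and $X$ a plane of the projective space $\mathbb{P}(\mathbb{F}^4)$ with $x\not\subset X$; $(x,X)\perp(y,Y)$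 iff $x\subset Y$ and $y\subset X$. Let $V=\mathbb{F}^4$, $V^*$ its dual. $\widetilde H_3(\mathbb{F})$ is the graph whose vertices are the tensors $v\otimes f\in V\otimes V^*$ with $v\in V$, $f\in V^*$, $f(v)\neq0$, with $v\otimes f\perp w\otimes g$ iff $f(w)=g(v)=0$. Let $W=\bigwedge^2V$. Fix an isomorphism $\chi:\bigwedge^4V\to\mathbb{F}$. Identify $\bigwedge^2V^*$ with $(\bigwedge^2V)^*$ via $(f_1\wedge f_2)(v_1\wedge v_2)=f_1(v_1)f_2(v_2)-f_1(v_2)f_2(v_1)$; let $\psi:\bigwedge^2V\to(\bigwedge^2V)^*=\bigwedge^2V^*$ be given by $\psi(\hat w)(\hat v)=\chi(\hat v\wedge\hat w)$, and $\phi=\psi^{-1}:\bigwedge^2V^*\to\bigwedge^2V$. Let $S_2(W)$ be the symmetric square of $W$, with the image of $a\otimes b$ written $ab$. Define $U=(w\wedge x)(y\wedge z)+(w\wedge y)(z\wedge x)+(w\wedge z)(x\wedge y)\in S_2(W)$ for any $w,x,y,z\in V$ with $\chi(w\wedge x\wedge y\wedge z)=1$ (this is independent of the choice). The voltage assignment $\ell:D(\widetilde H_3(\mathbb{F}))\to S_2(W)$ (additive group) assigns to the dart from $v_1\otimes h_1$ to $v_2\otimes h_2$ the element $h_1(v_1)^{-1}h_2(v_2)^{-1}(v_1\wedge v_2)\,\phi(h_1\wedge h_2)$, and $\ell^U$ is the composition of $\ell$ with the projection $S_2(W)\to S_2(W)/\langle U\rangle_{\mathbb{F}_2}$. *)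

theory Defs
  imports "HOL-Analysis.Analysis" "HOL-Library.Equipollence"
begin

definition nbhd :: "'v set \<Rightarrow> ('v \<Rightarrow> 'v \<Rightarrow> bool) \<Rightarrow> 'v \<Rightarrow> 'v set" where
  "nbhd V adj u = {w \<in> V. adj u w}"

definition reach :: "'v set \<Rightarrow> ('v \<Rightarrow> 'v \<Rightarrow> bool) \<Rightarrow> 'v \<Rightarrow> 'v \<Rightarrow> bool" where
  "reach V adj = (\<lambda>a b. a \<in> V \<and> b \<in> V \<and> adj a b)\<^sup>*\<^sup>*"

definition connected_graph :: "'v set \<Rightarrow> ('v \<Rightarrow> 'v \<Rightarrow> bool) \<Rightarrow> bool" where
  "connected_graph V adj \<longleftrightarrow> V \<noteq> {} \<and> (\<forall>u\<in>V. \<forall>w\<in>V. reach V adj u w)"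

definition component :: "'v set \<Rightarrow> ('v \<Rightarrow> 'v \<Rightarrow> bool) \<Rightarrow> 'v \<Rightarrow> 'v set" where
  "component V adj u = {w \<in> V. reach V adj u w}"

definition local_iso :: "'v set \<Rightarrow> ('v \<Rightarrow> 'v \<Rightarrow> bool) \<Rightarrow> 'w set \<Rightarrow> ('w \<Rightarrow> 'w \<Rightarrow> bool)
    \<Rightarrow> ('v \<Rightarrow> 'w) \<Rightarrow> bool" where
  "local_iso V adj V' adj' f \<longleftrightarrow>
     (\<forall>x\<in>V. f x \<in> V') \<and>
     (\<forall>x\<in>V. \<forall>y\<in>V. adj x y \<longrightarrow> adj' (f x) (f y)) \<and>
     (\<forall>x\<in>V. bij_betw f (nbhd V adj x) (nbhd V' adj' (f x)) \<and>
        (\<forall>a\<in>nbhd V adj x. \<forall>b\<in>nbhd V adj x. adj a b \<longleftrightarrow> adj' (f a) (f b)))"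

text \<open>Gamma is a k-fold cover of Delta, where the cardinal k is that of the set K
  (equipollence, so infinite cardinalities are handled).\<close>
definition k_fold_cover :: "'v set \<Rightarrow> ('v \<Rightarrow> 'v \<Rightarrow> bool) \<Rightarrow> 'w set \<Rightarrow> ('w \<Rightarrow> 'w \<Rightarrow> bool)
    \<Rightarrow> 'k set \<Rightarrow> bool" where
  "k_fold_cover V adj V' adj' K \<longleftrightarrow>
     connected_graph V adj \<and> connected_graph V' adj' \<and>
     (\<exists>f. local_iso V adj V' adj' f \<and> (\<forall>y\<in>V'. {x\<in>V. f x = y} \<approx> K))"

definition reduct_verts :: "'v set \<Rightarrow> ('v \<Rightarrow> 'v \<Rightarrow> bool) \<Rightarrow> 'v set set" where
  "reduct_verts V adj = {{w \<in> V. nbhd V adj w = nbhd V adj u} | u. u \<in> V}"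

definition reduct_adj :: "('v \<Rightarrow> 'v \<Rightarrow> bool) \<Rightarrow> 'v set \<Rightarrow> 'v set \<Rightarrow> bool" where
  "reduct_adj adj A B \<longleftrightarrow> (\<exists>a\<in>A. \<exists>b\<in>B. adj a b)"

section \<open>Linear algebra over F: V = F^4, V* = F^4 via the standard pairing\<close>

definition pair :: "'a::field ^ 4 \<Rightarrow> 'a ^ 4 \<Rightarrow> 'a" where
  "pair f v = (\<Sum>i\<in>UNIV. f $ i * v $ i)"

text \<open>v \<otimes> f in V \<otimes> V*, represented by its coordinate matrix.\<close>
definition tensor :: "'a::field ^ 4 \<Rightarrow> 'a ^ 4 \<Rightarrow> (4 \<Rightarrow> 4 \<Rightarrow> 'a)" where
  "tensor v f = (\<lambda>i j. v $ i * f $ j)"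

definition Ht_verts :: "(4 \<Rightarrow> 4 \<Rightarrow> 'a::field) set" where
  "Ht_verts = {tensor v f | v f. pair f v \<noteq> 0}"

definition Ht_adj :: "(4 \<Rightarrow> 4 \<Rightarrow> 'a::field) \<Rightarrow> (4 \<Rightarrow> 4 \<Rightarrow> 'a) \<Rightarrow> bool" where
  "Ht_adj T S \<longleftrightarrow> (\<exists>v f w g. T = tensor v f \<and> S = tensor w g \<and> pair f v \<noteq> 0 \<and> pair g w \<noteq> 0
                     \<and> pair f w = 0 \<and> pair g v = 0)"

section \<open>W = \<And>^2 V, represented by alternating 4x4 coordinate matrices
  (coordinates w.r.t. the basis e_i \<and> e_j, i<j); same for \<And>^2 V*\<close>

definition Wset :: "(4 \<Rightarrow> 4 \<Rightarrow> 'a::field) set" where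
  "Wset = {p. \<forall>i j. p i j = - p j i \<and> p i i = 0}"

definition wedge :: "'a::field ^ 4 \<Rightarrow> 'a ^ 4 \<Rightarrow> (4 \<Rightarrow> 4 \<Rightarrow> 'a)" where
  "wedge v w = (\<lambda>i j. v $ i * w $ j - v $ j * w $ i)"

text \<open>Evaluation of eta in \<And>^2 V* on p in \<And>^2 V (the identification
  (f1\<and>f2)(v1\<and>v2) = f1(v1)f2(v2) - f1(v2)f2(v1), i.e. dual bases).\<close>
definition evalW :: "(4 \<Rightarrow> 4 \<Rightarrow> 'a::field) \<Rightarrow> (4 \<Rightarrow> 4 \<Rightarrow> 'a) \<Rightarrow> 'a" where
  "evalW eta p = (\<Sum>i\<in>UNIV. \<Sum>j\<in>UNIV. if i < j then eta i j * p i j else 0)"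

text \<open>chi(p \<and> q) for p, q in W, where chi : \<And>^4 V \<rightarrow> F is the isomorphism sending
  e_0\<and>e_1\<and>e_2\<and>e_3 to c (every isomorphism has this form, c \<noteq> 0).  The bracket is the
  coefficient of p \<and> q on e_0\<and>e_1\<and>e_2\<and>e_3.\<close>
definition chiW :: "'a::field \<Rightarrow> (4 \<Rightarrow> 4 \<Rightarrow> 'a) \<Rightarrow> (4 \<Rightarrow> 4 \<Rightarrow> 'a) \<Rightarrow> 'a" where
  "chiW c p q = c * (p 0 1 * q 2 3 - p 0 2 * q 1 3 + p 0 3 * q 1 2
                   + p 1 2 * q 0 3 - p 1 3 * q 0 2 + p 2 3 * q 0 1)"

text \<open>phi = psi^{-1}, where psi(w)(v) = chi(v \<and> w).\<close>
definition phi :: "'a::field \<Rightarrow> (4 \<Rightarrow> 4 \<Rightarrow> 'a) \<Rightarrow> (4 \<Rightarrow> 4 \<Rightarrow> 'a)" where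
  "phi c eta = (THE w. w \<in> Wset \<and> (\<forall>v\<in>Wset. chiW c v w = evalW eta v))"

section \<open>S_2(W): coefficients of quadratic polynomials in the 6 coordinates of W,
  stored as a symmetric function on pairs of basis indices (i,j), i<j\<close>

definition upper :: "4 \<times> 4 \<Rightarrow> bool" where
  "upper P \<longleftrightarrow> fst P < snd P"

definition S2set :: "(4 \<times> 4 \<Rightarrow> 4 \<times> 4 \<Rightarrow> 'a::field) set" where
  "S2set = {s. \<forall>P Q. s P Q = s Q P \<and> (\<not> (upper P \<and> upper Q) \<longrightarrow> s P Q = 0)}"

definition symprod :: "(4 \<Rightarrow> 4 \<Rightarrow> 'a::field) \<Rightarrow> (4 \<Rightarrow> 4 \<Rightarrow> 'a) \<Rightarrow> (4 \<times> 4 \<Rightarrow> 4 \<times> 4 \<Rightarrow> 'a)" where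
  "symprod p q = (\<lambda>P Q. if upper P \<and> upper Q then
       (if P = Q then p (fst P) (snd P) * q (fst P) (snd P)
        else p (fst P) (snd P) * q (fst Q) (snd Q) + p (fst Q) (snd Q) * q (fst P) (snd P))
     else 0)"

definition s2add :: "(4 \<times> 4 \<Rightarrow> 4 \<times> 4 \<Rightarrow> 'a::field) \<Rightarrow> _ \<Rightarrow> _" where
  "s2add s t = (\<lambda>P Q. s P Q + t P Q)"

definition s2sub :: "(4 \<times> 4 \<Rightarrow> 4 \<times> 4 \<Rightarrow> 'a::field) \<Rightarrow> _ \<Rightarrow> _" where
  "s2sub s t = (\<lambda>P Q. s P Q - t P Q)"

definition s2scale :: "'a::field \<Rightarrow> (4 \<times> 4 \<Rightarrow> 4 \<times> 4 \<Rightarrow> 'a) \<Rightarrow> _" where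
  "s2scale a s = (\<lambda>P Q. a * s P Q)"

definition s2zero :: "4 \<times> 4 \<Rightarrow> 4 \<times> 4 \<Rightarrow> 'a::field" where
  "s2zero = (\<lambda>P Q. 0)"

definition UU :: "'a::field \<Rightarrow> (4 \<times> 4 \<Rightarrow> 4 \<times> 4 \<Rightarrow> 'a)" where
  "UU c = (SOME u. \<exists>w x y z. chiW c (wedge w x) (wedge y z) = 1 \<and>
      u = s2add (s2add (symprod (wedge w x) (wedge y z)) (symprod (wedge w y) (wedge z x)))
                (symprod (wedge w z) (wedge x y)))"

definition volt :: "'a::field \<Rightarrow> 'a^4 \<Rightarrow> 'a^4 \<Rightarrow> 'a^4 \<Rightarrow> 'a^4 \<Rightarrow> (4 \<times> 4 \<Rightarrow> 4 \<times> 4 \<Rightarrow> 'a)" where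
  "volt c v1 h1 v2 h2 = s2scale (inverse (pair h1 v1) * inverse (pair h2 v2))
      (symprod (wedge v1 v2) (phi c (wedge h1 h2)))"

definition rep :: "(4 \<Rightarrow> 4 \<Rightarrow> 'a::field) \<Rightarrow> ('a^4) \<times> ('a^4)" where
  "rep T = (SOME vh. T = tensor (fst vh) (snd vh) \<and> pair (snd vh) (fst vh) \<noteq> 0)"

definition ell :: "'a::field \<Rightarrow> (4 \<Rightarrow> 4 \<Rightarrow> 'a) \<Rightarrow> (4 \<Rightarrow> 4 \<Rightarrow> 'a) \<Rightarrow> (4 \<times> 4 \<Rightarrow> 4 \<times> 4 \<Rightarrow> 'a)" where
  "ell c T S = volt c (fst (rep T)) (snd (rep T)) (fst (rep S)) (snd (rep S))"

text \<open>The additive subgroup generated by U (over F_2); in characteristic 2 it is {0, U}.\<close>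
definition HU :: "'a::field \<Rightarrow> (4 \<times> 4 \<Rightarrow> 4 \<times> 4 \<Rightarrow> 'a) set" where
  "HU c = {s2zero, UU c}"

definition cls :: "'a::field \<Rightarrow> (4 \<times> 4 \<Rightarrow> 4 \<times> 4 \<Rightarrow> 'a) \<Rightarrow> (4 \<times> 4 \<Rightarrow> 4 \<times> 4 \<Rightarrow> 'a) set" where
  "cls c x = {s2add x h | h. h \<in> HU c}"

definition Nq :: "'a::field \<Rightarrow> (4 \<times> 4 \<Rightarrow> 4 \<times> 4 \<Rightarrow> 'a) set set" where
  "Nq c = cls c ` S2set"

definition qsub :: "(4 \<times> 4 \<Rightarrow> 4 \<times> 4 \<Rightarrow> 'a::field) set \<Rightarrow> _ set \<Rightarrow> _ set" where
  "qsub A B = {s2sub x y | x y. x \<in> A \<and> y \<in> B}"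

definition ellU :: "'a::field \<Rightarrow> (4 \<Rightarrow> 4 \<Rightarrow> 'a) \<Rightarrow> (4 \<Rightarrow> 4 \<Rightarrow> 'a) \<Rightarrow> (4 \<times> 4 \<Rightarrow> 4 \<times> 4 \<Rightarrow> 'a) set" where
  "ellU c T S = cls c (ell c T S)"

definition Lverts :: "'a::field \<Rightarrow> ((4 \<Rightarrow> 4 \<Rightarrow> 'a) \<times> (4 \<times> 4 \<Rightarrow> 4 \<times> 4 \<Rightarrow> 'a) set) set" where
  "Lverts c = Ht_verts \<times> Nq c"

definition Ladj :: "'a::field \<Rightarrow> (4 \<Rightarrow> 4 \<Rightarrow> 'a) \<times> (4 \<times> 4 \<Rightarrow> 4 \<times> 4 \<Rightarrow> 'a) set
     \<Rightarrow> (4 \<Rightarrow> 4 \<Rightarrow> 'a) \<times> (4 \<times> 4 \<Rightarrow> 4 \<times> 4 \<Rightarrow> 'a) set \<Rightarrow> bool" where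
  "Ladj c x y \<longleftrightarrow> Ht_adj (fst x) (fst y) \<and> ellU c (fst x) (fst y) = qsub (snd x) (snd y)"

definition Gverts where "Gverts c = reduct_verts (Lverts c) (Ladj c)"
definition Gadj where "Gadj c = reduct_adj (Ladj c)"

definition pt :: "'a::field ^ 4 \<Rightarrow> ('a ^ 4) set" where
  "pt v = {a *s v | a. True}"

definition pl :: "'a::field ^ 4 \<Rightarrow> ('a ^ 4) set" where
  "pl f = {w. pair f w = 0}"

definition H3_verts :: "(('a::field ^ 4) set \<times> ('a ^ 4) set) set" where
  "H3_verts = {(pt v, pl f) | v f. v \<noteq> 0 \<and> f \<noteq> 0 \<and> \<not> pt v \<subseteq> pl f}"

definition H3_adj :: "('a::field ^ 4) set \<times> ('a ^ 4) set \<Rightarrow> ('a ^ 4) set \<times> ('a ^ 4) set \<Rightarrow> bool" where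
  "H3_adj a b \<longleftrightarrow> fst a \<subseteq> snd b \<and> fst b \<subseteq> snd a"

end

theory Submission
  imports Defs "HOL-Library.Function_Algebras"
begin

text \<open>
  The voltage of a dart of the graph on tensors depends only on the two underlying point-plane pairs, so
  the reduct of the lift is the lift of \<open>H\<^sub>3\<close> itself. In characteristic 2 the
  voltages around a triangle add up to \<open>U\<close>, so the projection to \<open>H\<^sub>3\<close> is a local
  isomorphism, and the fibre of a component is a coset of the group of voltages of closed walks.
  Modulo \<open>U\<close> and the \<open>F\<close>-span \<open>Q\<close> of the squares in \<open>S\<^sub>2(W)\<close>
  the voltage is a coboundary: it is \<open>\<rho>(T\<^sub>1) - \<rho>(T\<^sub>2)\<close> for a map \<open>\<rho>\<close> that is
  linear in the idempotents \<open>T = v \<otimes> f / f(v)\<close>. So closed walks have voltage in \<open>Q\<close>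
  modulo \<open>U\<close>. Conversely, the 4-cycles through \<open>e\<^sub>i \<otimes> e\<^sub>i\<^sup>*\<close>,
  \<open>e\<^sub>j \<otimes> e\<^sub>j\<^sup>*\<close>, \<open>e\<^sub>i \<otimes> (e\<^sub>i\<^sup>* + c a e\<^sub>k\<^sup>*)\<close> and
  \<open>e\<^sub>j \<otimes> (e\<^sub>j\<^sup>* + e\<^sub>l\<^sup>*)\<close> have voltage \<open>a (e\<^sub>i \<and> e\<^sub>j)\<^sup>2\<close>, and
  these generate \<open>Q\<close>, a space of dimension 6 that meets \<open>{0, U}\<close> trivially.
\<close>

section \<open>Graphs and covers\<close>

lemma reach_trans: "reach V adj a b \<Longrightarrow> reach V adj b c \<Longrightarrow> reach V adj a c"
  unfolding reach_def by (rule rtranclp_trans)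

lemma reach_refl [simp]: "reach V adj a a"
  unfolding reach_def by simp

lemma reach_edge: "a \<in> V \<Longrightarrow> b \<in> V \<Longrightarrow> adj a b \<Longrightarrow> reach V adj a b"
  unfolding reach_def by (rule r_into_rtranclp) simp

lemma reach_induct [consumes 1, case_names refl step]:
  assumes "reach V adj a b" and "P a"
    and "\<And>x y. reach V adj a x \<Longrightarrow> x \<in> V \<Longrightarrow> y \<in> V \<Longrightarrow> adj x y \<Longrightarrow> P x \<Longrightarrow> P y"
  shows "P b"
  using assms(1) unfolding reach_def
proof (induction rule: rtranclp_induct)
  case base
  show ?case by (rule assms(2))
next
  case (step y z)
  then show ?case using assms(3)[of y z] by (simp add: reach_def)
qed

lemma reach_sym:
  assumes sym: "\<And>x y. x \<in> V \<Longrightarrow> y \<in> V \<Longrightarrow> adj x y \<Longrightarrow> adj y x"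
    and "reach V adj a b"
  shows "reach V adj b a"
  using assms(2)
proof (induction rule: reach_induct)
  case (step x y)
  have "reach V adj y x" using step(2,3) sym[OF step(2,3,4)] by (intro reach_edge)
  then show ?case using step(5) by (rule reach_trans)
qed simp

lemma reach_map:
  assumes "reach V adj a b"
    and "\<And>x. x \<in> V \<Longrightarrow> h x \<in> V'"
    and "\<And>x y. x \<in> V \<Longrightarrow> y \<in> V \<Longrightarrow> adj x y \<Longrightarrow> adj' (h x) (h y)"
  shows "reach V' adj' (h a) (h b)"
  using assms(1)
proof (induction rule: reach_induct)
  case (step x y)
  have "reach V' adj' (h x) (h y)" using step(2-4) assms(2,3) by (intro reach_edge)
  with step(5) show ?case by (rule reach_trans)
qed simp

lemma reach_component:
  assumes "reach V adj u w" and "u \<in> V"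
  shows "reach (component V adj u) adj u w"
  using assms(1)
proof (induction rule: reach_induct)
  case (step x y)
  have "reach V adj u y" using step(1) reach_edge[OF step(2,3), of adj, OF step(4)] by (rule reach_trans)
  then have "x \<in> component V adj u" "y \<in> component V adj u"
    using step(1-3) by (auto simp: component_def)
  then have "reach (component V adj u) adj x y" using step(4) by (rule reach_edge)
  with step(5) show ?case by (rule reach_trans)
qed simp

lemma connected_graph_component:
  assumes "\<And>x y. x \<in> V \<Longrightarrow> y \<in> V \<Longrightarrow> adj x y \<Longrightarrow> adj y x" and "u \<in> V"
  shows "connected_graph (component V adj u) adj"
proof -
  have sub: "component V adj u \<subseteq> V" by (auto simp: component_def)
  have from_u: "reach (component V adj u) adj u x" if "x \<in> component V adj u" for x
    using that assms(2) reach_component[of V adj u x] by (simp add: component_def)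
  have to_u: "reach (component V adj u) adj x u" if "x \<in> component V adj u" for x
    using assms(1) sub by (intro reach_sym[OF _ from_u[OF that]]) auto
  have "u \<in> component V adj u" using assms(2) by (simp add: component_def)
  then show ?thesis unfolding connected_graph_def
    using reach_trans[OF to_u from_u] by blast
qed

lemma nbhd_component:
  assumes "x \<in> component V adj u"
  shows "nbhd (component V adj u) adj x = nbhd V adj x"
proof -
  have "reach V adj u w" if "w \<in> V" "adj x w" for w
    using assms that reach_trans[of V adj u x w] reach_edge[of x V w adj] by (simp add: component_def)
  then show ?thesis by (auto simp: nbhd_def component_def)
qed

lemma local_iso_component:
  assumes "local_iso V adj V' adj' f"
  shows "local_iso (component V adj u) adj V' adj' f"
proof -
  have sub: "component V adj u \<subseteq> V" by (auto simp: component_def)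
  show ?thesis
    using assms sub unfolding local_iso_def by (auto simp: nbhd_component subset_iff)
qed

section \<open>Covers and components under isomorphism, and reducts\<close>

lemma k_fold_cover_iso:
  assumes bij: "bij_betw \<phi> V W"
    and adj: "\<And>x y. x \<in> V \<Longrightarrow> y \<in> V \<Longrightarrow> adj x y \<longleftrightarrow> adj' (\<phi> x) (\<phi> y)"
    and cover: "k_fold_cover W adj' D adjD K"
  shows "k_fold_cover V adj D adjD K"
proof -
  obtain f where conn: "connected_graph W adj'" "connected_graph D adjD"
    and f: "local_iso W adj' D adjD f" and fib: "\<And>y. y \<in> D \<Longrightarrow> {x \<in> W. f x = y} \<approx> K"
    using cover unfolding k_fold_cover_def by blast
  have inj: "inj_on \<phi> V" and img: "\<phi> ` V = W" using bij by (auto simp: bij_betw_def)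
  have mem: "\<phi> x \<in> W" if "x \<in> V" for x using that img by blast
  define \<psi> where "\<psi> = inv_into V \<phi>"
  have \<psi>: "\<psi> (\<phi> x) = x" if "x \<in> V" for x using that inj by (simp add: \<psi>_def)
  have \<psi>_mem: "\<psi> y \<in> V" and \<phi>\<psi>: "\<phi> (\<psi> y) = y" if "y \<in> W" for y
    using that img by (auto simp: \<psi>_def inv_into_into f_inv_into_f)
  have nb: "bij_betw \<phi> (nbhd V adj x) (nbhd W adj' (\<phi> x))" if "x \<in> V" for x
    unfolding bij_betw_def
  proof
    show "inj_on \<phi> (nbhd V adj x)" using inj by (rule inj_on_subset) (auto simp: nbhd_def)
    show "\<phi> ` nbhd V adj x = nbhd W adj' (\<phi> x)"
      using that adj img by (force simp: nbhd_def)
  qed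
  have "connected_graph V adj"
    unfolding connected_graph_def
  proof (intro conjI ballI)
    show "V \<noteq> {}" using conn(1) img by (auto simp: connected_graph_def)
    fix u w assume uw: "u \<in> V" "w \<in> V"
    then have "reach W adj' (\<phi> u) (\<phi> w)" using conn(1) mem by (auto simp: connected_graph_def)
    then have "reach V adj (\<psi> (\<phi> u)) (\<psi> (\<phi> w))"
      by (rule reach_map) (auto simp: \<psi>_mem \<phi>\<psi> adj)
    then show "reach V adj u w" using uw by (simp add: \<psi>)
  qed
  moreover have "local_iso V adj D adjD (f \<circ> \<phi>)"
    unfolding local_iso_def
  proof (intro conjI ballI impI)
    fix x assume x: "x \<in> V"
    show "(f \<circ> \<phi>) x \<in> D" using f mem[OF x] by (auto simp: local_iso_def)
    have "bij_betw f (nbhd W adj' (\<phi> x)) (nbhd D adjD (f (\<phi> x)))"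
      using f mem[OF x] by (auto simp: local_iso_def)
    from bij_betw_trans[OF nb[OF x] this]
    show "bij_betw (f \<circ> \<phi>) (nbhd V adj x) (nbhd D adjD ((f \<circ> \<phi>) x))" by simp
    fix a b assume ab: "a \<in> nbhd V adj x" "b \<in> nbhd V adj x"
    then have m: "\<phi> a \<in> nbhd W adj' (\<phi> x)" "\<phi> b \<in> nbhd W adj' (\<phi> x)" "a \<in> V" "b \<in> V"
      using nb[OF x] by (auto simp: bij_betw_def nbhd_def)
    show "adj a b \<longleftrightarrow> adjD ((f \<circ> \<phi>) a) ((f \<circ> \<phi>) b)"
      using f m mem[OF x] by (auto simp: local_iso_def adj)
  next
    fix x y assume "x \<in> V" "y \<in> V" "adj x y"
    then show "adjD ((f \<circ> \<phi>) x) ((f \<circ> \<phi>) y)" using f mem by (auto simp: local_iso_def adj)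
  qed
  moreover have "{x \<in> V. (f \<circ> \<phi>) x = y} \<approx> K" if "y \<in> D" for y
  proof -
    have "bij_betw \<phi> {x \<in> V. (f \<circ> \<phi>) x = y} {x \<in> W. f x = y}"
      unfolding bij_betw_def
    proof
      show "inj_on \<phi> {x \<in> V. (f \<circ> \<phi>) x = y}" using inj by (rule inj_on_subset) auto
    qed (use img in auto)
    then have "{x \<in> V. (f \<circ> \<phi>) x = y} \<approx> {x \<in> W. f x = y}" by (auto simp: eqpoll_def)
    then show ?thesis using fib[OF that] eqpoll_trans by blast
  qed
  ultimately show ?thesis using conn(2) unfolding k_fold_cover_def by blast
qed

lemma bij_betw_component:
  assumes bij: "bij_betw \<phi> V W"
    and adj: "\<And>x y. x \<in> V \<Longrightarrow> y \<in> V \<Longrightarrow> adj x y \<longleftrightarrow> adj' (\<phi> x) (\<phi> y)"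
    and u: "u \<in> V"
  shows "bij_betw \<phi> (component V adj u) (component W adj' (\<phi> u))"
proof -
  have inj: "inj_on \<phi> V" and img: "\<phi> ` V = W" using bij by (auto simp: bij_betw_def)
  define \<psi> where "\<psi> = inv_into V \<phi>"
  have \<psi>: "\<psi> (\<phi> x) = x" if "x \<in> V" for x using that inj by (simp add: \<psi>_def)
  have \<psi>_mem: "\<psi> y \<in> V" and \<phi>\<psi>: "\<phi> (\<psi> y) = y" if "y \<in> W" for y
    using that img by (auto simp: \<psi>_def inv_into_into f_inv_into_f)
  have iff: "reach V adj u w \<longleftrightarrow> reach W adj' (\<phi> u) (\<phi> w)" if "w \<in> V" for w
  proof
    assume "reach V adj u w"
    then show "reach W adj' (\<phi> u) (\<phi> w)" by (rule reach_map) (use adj img in auto)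
  next
    assume "reach W adj' (\<phi> u) (\<phi> w)"
    then have "reach V adj (\<psi> (\<phi> u)) (\<psi> (\<phi> w))"
      by (rule reach_map) (auto simp: \<psi>_mem \<phi>\<psi> adj)
    then show "reach V adj u w" using u that by (simp add: \<psi>)
  qed
  show ?thesis unfolding bij_betw_def
  proof
    show "inj_on \<phi> (component V adj u)"
      using inj by (rule inj_on_subset) (auto simp: component_def)
    show "\<phi> ` component V adj u = component W adj' (\<phi> u)"
      using iff img by (auto simp: component_def)
  qed
qed

text \<open>Adjacency in \<open>V\<close> is pulled back along \<open>q\<close>, so vertices with
  the same image have equal neighbourhoods; the converse holds because distinct vertices of
  \<open>W\<close> have distinct neighbourhoods. The classes are therefore exactly the fibres of
  \<open>q\<close>.\<close>

lemma reduct_iso: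
  assumes img: "q ` V = W"
    and adj: "\<And>x y. x \<in> V \<Longrightarrow> y \<in> V \<Longrightarrow> adj x y \<longleftrightarrow> adj' (q x) (q y)"
    and inj: "inj_on (nbhd W adj') W"
  shows "\<exists>\<phi>. bij_betw \<phi> (reduct_verts V adj) W \<and>
    (\<forall>A\<in>reduct_verts V adj. \<forall>B\<in>reduct_verts V adj. reduct_adj adj A B \<longleftrightarrow> adj' (\<phi> A) (\<phi> B))"
proof -
  have mem: "q x \<in> W" if "x \<in> V" for x using that img by blast
  have nb: "nbhd V adj x = {y \<in> V. q y \<in> nbhd W adj' (q x)}" if "x \<in> V" for x
    using that adj mem by (auto simp: nbhd_def)
  have eq: "nbhd V adj w = nbhd V adj u \<longleftrightarrow> q w = q u" if uw: "u \<in> V" "w \<in> V" for u w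
  proof
    assume *: "nbhd V adj w = nbhd V adj u"
    have "q ` nbhd V adj x = nbhd W adj' (q x)" if "x \<in> V" for x
      using nb[OF that] img by (auto simp: nbhd_def)
    then have "nbhd W adj' (q w) = nbhd W adj' (q u)" using uw * by metis
    then show "q w = q u" using inj uw mem by (auto dest: inj_onD)
  qed (use nb uw in simp)
  define fib where "fib y = {x \<in> V. q x = y}" for y
  have verts: "reduct_verts V adj = fib ` W"
  proof -
    have "{w \<in> V. nbhd V adj w = nbhd V adj u} = fib (q u)" if "u \<in> V" for u
      using eq that by (auto simp: fib_def)
    then have "reduct_verts V adj = (\<lambda>u. fib (q u)) ` V" by (auto simp: reduct_verts_def)
    then show ?thesis using img by (simp flip: img add: image_image)
  qed
  have ne: "\<exists>x\<in>V. q x = y" if "y \<in> W" for y using that img by blast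
  have inj_fib: "inj_on fib W"
    by (rule inj_onI) (use ne in \<open>fastforce simp: fib_def\<close>)
  show ?thesis
  proof (intro exI[of _ "inv_into W fib"] conjI ballI)
    show "bij_betw (inv_into W fib) (reduct_verts V adj) W"
      unfolding verts by (rule bij_betw_inv_into) (simp add: bij_betw_def inj_fib)
    fix A B assume "A \<in> reduct_verts V adj" "B \<in> reduct_verts V adj"
    then obtain a b where ab: "a \<in> W" "A = fib a" "b \<in> W" "B = fib b" unfolding verts by blast
    have "reduct_adj adj A B \<longleftrightarrow> adj' a b"
      using ab ne[of a] ne[of b] adj by (auto simp: reduct_adj_def fib_def)
    then show "reduct_adj adj A B \<longleftrightarrow> adj' (inv_into W fib A) (inv_into W fib B)"
      using ab inj_fib by simp
  qed
qed

section \<open>Lifts by voltages in a quotient group\<close>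

text \<open>The voltage group is \<open>S / K\<close>, with \<open>cl\<close> as the class map, so
  voltages can be computed in \<open>S\<close> before passing to classes. The assumption
  \<open>triangle\<close> says that triangles have trivial voltage in \<open>S / K\<close>; this is
  what turns the projection into a local isomorphism.\<close>

locale voltage_lift =
  fixes D :: "'d set" and adjD :: "'d \<Rightarrow> 'd \<Rightarrow> bool" and vol :: "'d \<Rightarrow> 'd \<Rightarrow> 'g::ab_group_add"
    and S K :: "'g set" and cl :: "'g \<Rightarrow> 'n"
    and adj :: "'d \<times> 'n \<Rightarrow> 'd \<times> 'n \<Rightarrow> bool"
  assumes conn: "connected_graph D adjD"
    and adjD_sym: "adjD a b \<Longrightarrow> adjD b a"
    and S_zero: "0 \<in> S"
    and S_diff: "x \<in> S \<Longrightarrow> y \<in> S \<Longrightarrow> x - y \<in> S"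
    and K_sub: "K \<subseteq> S"
    and K_zero: "0 \<in> K"
    and K_diff: "x \<in> K \<Longrightarrow> y \<in> K \<Longrightarrow> x - y \<in> K"
    and cl_eq: "cl x = cl y \<longleftrightarrow> x - y \<in> K"
    and vol_mem: "a \<in> D \<Longrightarrow> b \<in> D \<Longrightarrow> adjD a b \<Longrightarrow> vol a b \<in> S"
    and vol_skew: "a \<in> D \<Longrightarrow> b \<in> D \<Longrightarrow> adjD a b \<Longrightarrow> vol b a = - vol a b"
    and triangle: "a \<in> D \<Longrightarrow> b \<in> D \<Longrightarrow> d \<in> D \<Longrightarrow> adjD a b \<Longrightarrow> adjD b d \<Longrightarrow> adjD d a \<Longrightarrow>
      vol a b + vol b d + vol d a \<in> K"
    and adj_iff: "a \<in> D \<Longrightarrow> b \<in> D \<Longrightarrow> x \<in> S \<Longrightarrow> y \<in> S \<Longrightarrow>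
      adj (a, cl x) (b, cl y) \<longleftrightarrow> adjD a b \<and> cl (vol a b) = cl (x - y)"
begin

abbreviation "V \<equiv> D \<times> cl ` S"

lemma S_minus: "x \<in> S \<Longrightarrow> - x \<in> S"
  using S_diff[OF S_zero] by fastforce

lemma S_add: "x \<in> S \<Longrightarrow> y \<in> S \<Longrightarrow> x + y \<in> S"
  using S_diff[OF _ S_minus] by fastforce

lemma K_minus: "x \<in> K \<Longrightarrow> - x \<in> K"
  using K_diff[OF K_zero] by fastforce

lemma K_add: "x \<in> K \<Longrightarrow> y \<in> K \<Longrightarrow> x + y \<in> K"
  using K_diff[OF _ K_minus] by fastforce

lemma cl_add_cong: "cl x = cl x' \<Longrightarrow> cl (x + y) = cl (x' + y)"
  unfolding cl_eq by simp

lemma adj_sym: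
  assumes "p \<in> V" "r \<in> V" "adj p r"
  shows "adj r p"
proof -
  obtain a x b y where p: "p = (a, cl x)" "a \<in> D" "x \<in> S" and r: "r = (b, cl y)" "b \<in> D" "y \<in> S"
    using assms(1,2) by auto
  have ab: "adjD a b" "vol a b - (x - y) \<in> K" using assms(3) p r adj_iff cl_eq by auto
  have "- vol a b - (y - x) = - (vol a b - (x - y))" by simp
  then have "- vol a b - (y - x) \<in> K" using K_minus[OF ab(2)] by (simp only:)
  then show ?thesis using p r adjD_sym[OF ab(1)] by (simp add: adj_iff cl_eq vol_skew[OF p(2) r(2) ab(1)])
qed

lemma adj_step:
  assumes "a \<in> D" "b \<in> D" "x \<in> S" "adjD a b"
  shows "adj (a, cl x) (b, cl (x - vol a b))" "x - vol a b \<in> S"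
  using assms by (auto simp: adj_iff S_diff vol_mem)

text \<open>The voltage of a dart fixes the class at its other end, so each neighbour of
  \<open>a\<close> lifts to exactly one neighbour of \<open>(a, cl x)\<close>.\<close>

lemma nbhd_eq:
  assumes "a \<in> D" "x \<in> S"
  shows "nbhd V adj (a, cl x) = (\<lambda>b. (b, cl (x - vol a b))) ` nbhd D adjD a"
proof (intro equalityI subsetI)
  fix p assume "p \<in> nbhd V adj (a, cl x)"
  then obtain b y where p: "p = (b, cl y)" "b \<in> D" "y \<in> S" "adj (a, cl x) (b, cl y)"
    by (auto simp: nbhd_def)
  then have b: "adjD a b" "vol a b - (x - y) \<in> K" using assms adj_iff cl_eq by auto
  have "y - (x - vol a b) = vol a b - (x - y)" by simp
  then have "cl y = cl (x - vol a b)" using b(2) by (simp only: cl_eq)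
  then show "p \<in> (\<lambda>b. (b, cl (x - vol a b))) ` nbhd D adjD a"
    using p b(1) by (simp add: nbhd_def)
next
  fix p assume "p \<in> (\<lambda>b. (b, cl (x - vol a b))) ` nbhd D adjD a"
  then show "p \<in> nbhd V adj (a, cl x)" using assms adj_step by (auto simp: nbhd_def)
qed

text \<open>The neighbourhood projects onto that of the base vertex, which determines
  \<open>a\<close>; the class over any one neighbour then determines \<open>cl x\<close>. This
  provides the injectivity required by \<open>reduct_iso\<close>.\<close>

lemma nbhd_inj:
  assumes inj: "inj_on (nbhd D adjD) D" and ne: "\<And>a. a \<in> D \<Longrightarrow> nbhd D adjD a \<noteq> {}"
  shows "inj_on (nbhd V adj) V"
proof (rule inj_onI)
  fix p r assume pr: "p \<in> V" "r \<in> V" and eq: "nbhd V adj p = nbhd V adj r"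
  obtain a x b y where p: "p = (a, cl x)" "a \<in> D" "x \<in> S" and r: "r = (b, cl y)" "b \<in> D" "y \<in> S"
    using pr by auto
  have nb: "(\<lambda>d. (d, cl (x - vol a d))) ` nbhd D adjD a = (\<lambda>d. (d, cl (y - vol b d))) ` nbhd D adjD b"
    using eq p r by (simp add: nbhd_eq)
  then have "fst ` (\<lambda>d. (d, cl (x - vol a d))) ` nbhd D adjD a
      = fst ` (\<lambda>d. (d, cl (y - vol b d))) ` nbhd D adjD b" by simp
  then have "nbhd D adjD a = nbhd D adjD b" by (simp add: image_image)
  then have ab: "a = b" using inj p r by (auto dest: inj_onD)
  obtain d where "d \<in> nbhd D adjD a" using ne p by blast
  then have "cl (x - vol a d) = cl (y - vol a d)" using nb ab by auto
  then show "p = r" using p r ab by (simp add: cl_eq)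
qed

text \<open>Unique lifting of neighbours gives the bijection on neighbourhoods. An edge between two
  neighbours of a vertex closes a triangle below, and it lifts because the triangle has trivial
  voltage modulo \<open>K\<close>.\<close>

lemma local_iso_fst: "local_iso V adj D adjD fst"
proof -
  have bij: "bij_betw fst (nbhd V adj (a, cl x)) (nbhd D adjD a)" if "a \<in> D" "x \<in> S" for a x
    unfolding nbhd_eq[OF that] by (auto simp: bij_betw_def inj_on_def image_image)
  have loc: "adj p r \<longleftrightarrow> adjD (fst p) (fst r)"
    if asm: "a \<in> D" "x \<in> S" "p \<in> nbhd V adj (a, cl x)" "r \<in> nbhd V adj (a, cl x)" for a x p r
  proof -
    obtain b d where p: "p = (b, cl (x - vol a b))" and r: "r = (d, cl (x - vol a d))"
      and bd: "b \<in> D" "adjD a b" "d \<in> D" "adjD a d"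
      using asm(3,4) unfolding nbhd_eq[OF asm(1,2)] by (auto simp: nbhd_def)
    have "cl (vol b d) = cl ((x - vol a b) - (x - vol a d))" if "adjD b d"
    proof -
      have "vol a b + vol b d + vol d a \<in> K"
        using triangle[OF asm(1) bd(1,3) bd(2) that adjD_sym[OF bd(4)]] .
      then show ?thesis using bd asm(1) by (simp add: cl_eq vol_skew[of a d] algebra_simps)
    qed
    then show ?thesis
      unfolding p r using bd asm(1,2) by (auto simp: adj_iff S_diff vol_mem)
  qed
  show ?thesis
    unfolding local_iso_def using bij loc by (auto simp: adj_iff)
qed

text \<open>Adding a fixed element of \<open>S\<close> to the second coordinate preserves adjacency,
  which sees only differences.\<close>

lemma reach_translate:
  assumes "reach V adj (a, cl x) (b, cl y)" "x \<in> S" "y \<in> S" "s \<in> S"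
  shows "reach V adj (a, cl (x + s)) (b, cl (y + s))"
proof -
  \<comment> \<open>On classes the shift goes through a chosen representative;
    \<open>cl_add_cong\<close> makes the choice irrelevant.\<close>
  define h where "h = (\<lambda>p :: 'd \<times> 'n. (fst p, cl ((SOME z. z \<in> S \<and> cl z = snd p) + s)))"
  have h: "h (d, cl z) = (d, cl (z + s))" if "z \<in> S" for d z
  proof -
    have "(SOME z'. z' \<in> S \<and> cl z' = cl z) \<in> S \<and> cl (SOME z'. z' \<in> S \<and> cl z' = cl z) = cl z"
      by (rule someI[of _ z]) (use that in simp)
    then show ?thesis by (auto simp: h_def intro: cl_add_cong)
  qed
  have "reach V adj (h (a, cl x)) (h (b, cl y))"
    using assms(1)
  proof (rule reach_map)
    show "h p \<in> V" if "p \<in> V" for p using that assms(4) by (auto simp: h S_add)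
    show "adj (h p) (h r)" if "p \<in> V" "r \<in> V" "adj p r" for p r
      using that assms(4) by (auto simp: h adj_iff S_add)
  qed
  then show ?thesis using assms by (simp add: h)
qed

section \<open>Closed walks and the fibres of a component\<close>

lemma reach_lift:
  assumes "a \<in> D" "b \<in> D" "x \<in> S"
  obtains y where "y \<in> S" "reach V adj (a, cl x) (b, cl y)"
proof -
  have "reach D adjD a b" using conn assms by (auto simp: connected_graph_def)
  then have "\<exists>y\<in>S. reach V adj (a, cl x) (b, cl y)"
  proof (induction rule: reach_induct)
    case (step d e)
    then obtain y where y: "y \<in> S" "reach V adj (a, cl x) (d, cl y)" by blast
    have "reach V adj (d, cl y) (e, cl (y - vol d e))"
      using step y by (intro reach_edge) (auto simp: adj_step)
    then have "reach V adj (a, cl x) (e, cl (y - vol d e))" by (rule reach_trans[OF y(2)])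
    moreover have "y - vol d e \<in> S" using y(1) step by (simp add: S_diff vol_mem)
    ultimately show ?case by blast
  qed (use assms in \<open>auto intro!: bexI[of _ x]\<close>)
  then show thesis using that by blast
qed

text \<open>The shifts of the second coordinate that closed walks can produce. Quantifying over all
  starting vertices makes closure under addition immediate; \<open>loopsI\<close> shows that one
  starting vertex is enough.\<close>

definition loops :: "'g set" where
  "loops = {s \<in> S. \<forall>a\<in>D. \<forall>x\<in>S. reach V adj (a, cl x) (a, cl (x + s))}"

lemma loops_add: "s \<in> loops \<Longrightarrow> t \<in> loops \<Longrightarrow> s + t \<in> loops"
  unfolding loops_def
proof (intro CollectI conjI ballI)
  assume s: "s \<in> {s \<in> S. \<forall>a\<in>D. \<forall>x\<in>S. reach V adj (a, cl x) (a, cl (x + s))}"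
    and t: "t \<in> {s \<in> S. \<forall>a\<in>D. \<forall>x\<in>S. reach V adj (a, cl x) (a, cl (x + s))}"
  then show "s + t \<in> S" by (simp add: S_add)
  fix a x assume "a \<in> D" "x \<in> S"
  then have "reach V adj (a, cl x) (a, cl (x + s))" "reach V adj (a, cl (x + s)) (a, cl (x + s + t))"
    using s t S_add by auto
  then show "reach V adj (a, cl x) (a, cl (x + (s + t)))" unfolding add.assoc by (rule reach_trans)
qed

lemma loops_zero: "0 \<in> loops"
  by (simp add: loops_def S_zero)

text \<open>The group of closed walks does not depend on the base vertex, because the voltages
  commute.\<close>
lemma loopsI:
  assumes a: "a \<in> D" and x: "x \<in> S" and s: "s \<in> S" and r: "reach V adj (a, cl x) (a, cl (x + s))"
  shows "s \<in> loops"
  unfolding loops_def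
proof (intro CollectI conjI ballI s)
  fix b y assume b: "b \<in> D" and y: "y \<in> S"
  obtain z where z: "z \<in> S" "reach V adj (b, cl y) (a, cl z)" using reach_lift[OF b a y] .
  have "reach V adj (a, cl (x + (z - x))) (a, cl (x + s + (z - x)))"
    by (rule reach_translate[OF r]) (use x s z S_add S_diff in auto)
  then have "reach V adj (a, cl z) (a, cl (z + s))" by (simp add: algebra_simps)
  \<comment> \<open>The walk from \<open>b\<close> to \<open>a\<close>, shifted by \<open>s\<close>
    and reversed, leads back to \<open>b\<close>.\<close>
  moreover have "reach V adj (a, cl (z + s)) (b, cl (y + s))"
    using reach_sym[OF adj_sym reach_translate[OF z(2) y z(1) s]] by simp
  ultimately show "reach V adj (b, cl y) (b, cl (y + s))"
    using reach_trans[OF z(2) reach_trans] by blast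
qed

text \<open>The sign appears because a step along the dart from \<open>a\<close> to \<open>b\<close>
  subtracts \<open>vol a b\<close> from the second coordinate.\<close>

lemma loops_four_cycle:
  assumes D: "a \<in> D" "b \<in> D" "d \<in> D" "e \<in> D"
    and adj: "adjD a b" "adjD b d" "adjD d e" "adjD e a"
  shows "- (vol a b + vol b d + vol d e + vol e a) \<in> loops"
proof (rule loopsI[of a 0])
  have S: "0 - vol a b \<in> S" "0 - vol a b - vol b d \<in> S" "0 - vol a b - vol b d - vol d e \<in> S"
     "0 - vol a b - vol b d - vol d e - vol e a \<in> S"
    by (intro S_diff S_zero vol_mem D adj)+
  have edge: "reach V adj (p, cl x) (r, cl (x - vol p r))"
    if "p \<in> D" "r \<in> D" "x \<in> S" "adjD p r" for p r x
    using adj_step[OF that(1-4)] that by (intro reach_edge) auto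
  have "reach V adj (a, cl 0) (a, cl (0 - vol a b - vol b d - vol d e - vol e a))"
    by (rule reach_trans[OF edge[OF D(1,2) S_zero adj(1)] reach_trans[OF edge[OF D(2,3) S(1) adj(2)]
          reach_trans[OF edge[OF D(3,4) S(2) adj(3)] edge[OF D(4,1) S(3) adj(4)]]]])
  then show "reach V adj (a, cl 0) (a, cl (0 + - (vol a b + vol b d + vol d e + vol e a)))"
    by (simp add: algebra_simps)
  show "- (vol a b + vol b d + vol d e + vol e a) \<in> S"
    using S(4) by (simp add: algebra_simps)
qed (use D S_zero in auto)

text \<open>The fibre over \<open>b\<close> is the image of a coset of \<open>Q\<close> through one
  reached class: \<open>Q_loops\<close> supplies the points of the coset, the potential excludes all
  others, and \<open>QK\<close> keeps the points distinct.\<close>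

theorem component_cover:
  fixes pot :: "'d \<Rightarrow> 'g" and Q :: "'g set"
  assumes Q_loops: "Q \<subseteq> loops" and Q_zero: "0 \<in> Q"
    and Q_add: "\<And>x y. x \<in> Q \<Longrightarrow> y \<in> Q \<Longrightarrow> x + y \<in> Q"
    and Q_diff: "\<And>x y. x \<in> Q \<Longrightarrow> y \<in> Q \<Longrightarrow> x - y \<in> Q"
    and QK: "Q \<inter> K = {0}"
    and pot: "\<And>a b. a \<in> D \<Longrightarrow> b \<in> D \<Longrightarrow> adjD a b \<Longrightarrow>
       \<exists>q\<in>Q. \<exists>k\<in>K. vol a b - (pot a - pot b) = q + k"
    and Qk: "Q \<approx> k" and u: "u \<in> V"
  shows "k_fold_cover (component V adj u) adj D adjD k"
proof -
  obtain a x where a: "u = (a, cl x)" "a \<in> D" "x \<in> S" using u by auto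
  \<comment> \<open>Along a walk the potential differences telescope, so the second coordinate
    changes by the potential difference up to an element of \<open>Q + K\<close>.\<close>
  have inv: "\<exists>y q k. p = (b, cl y) \<and> y \<in> S \<and> q \<in> Q \<and> k \<in> K \<and> x - y - (pot a - pot b) = q + k"
    if "reach V adj u p" "fst p = b" for p b
    using that
  proof (induction arbitrary: b rule: reach_induct)
    case refl
    then show ?case using a Q_zero K_zero by force
  next
    case (step p r)
    obtain y q k where y: "p = (fst p, cl y)" "y \<in> S" "q \<in> Q" "k \<in> K"
        "x - y - (pot a - pot (fst p)) = q + k"
      using step.IH by blast
    obtain z where z: "r = (b, cl z)" "b \<in> D" "z \<in> S" using step by force
    define d where "d = fst p"
    have d: "d \<in> D" "adjD d b" "vol d b - (y - z) \<in> K"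
      using step.hyps y(1,2) z adj_iff[of d b y z] cl_eq d_def by (auto simp: mem_Times_iff)
    obtain q' k' where q': "q' \<in> Q" "k' \<in> K" "vol d b - (pot d - pot b) = q' + k'"
      using pot d(1,2) z(2) by blast
    have "x - z - (pot a - pot b) = (q + q') + (k + k' - (vol d b - (y - z)))"
      using y(5) q'(3) unfolding d_def[symmetric] by (simp add: algebra_simps)
    moreover have "k + k' - (vol d b - (y - z)) \<in> K" using y q' d K_add K_diff by blast
    ultimately show ?case using z Q_add y(3) q'(1) by blast
  qed
  have fibre: "{p \<in> component V adj u. fst p = b} \<approx> k" if b: "b \<in> D" for b
  proof -
    obtain y where y: "y \<in> S" "reach V adj u (b, cl y)" using reach_lift[OF a(2) b a(3)] a(1) by blast
    have Q_S: "Q \<subseteq> S" using Q_loops by (auto simp: loops_def)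
    have "bij_betw (\<lambda>q. (b, cl (y + q))) Q {p \<in> component V adj u. fst p = b}"
      unfolding bij_betw_def
    proof
      show "inj_on (\<lambda>q. (b, cl (y + q))) Q"
      proof (rule inj_onI)
        fix q q' assume q: "q \<in> Q" "q' \<in> Q" "(b, cl (y + q)) = (b, cl (y + q'))"
        then have "q - q' \<in> Q \<inter> K" using Q_diff by (auto simp: cl_eq)
        then show "q = q'" using QK by auto
      qed
      show "(\<lambda>q. (b, cl (y + q))) ` Q = {p \<in> component V adj u. fst p = b}"
      proof (intro equalityI subsetI)
        fix p assume "p \<in> (\<lambda>q. (b, cl (y + q))) ` Q"
        then obtain q where q: "q \<in> Q" "p = (b, cl (y + q))" by blast
        have "reach V adj (b, cl y) p" using q Q_loops b y by (auto simp: loops_def)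
        then have "reach V adj u p" using y reach_trans by metis
        then show "p \<in> {p \<in> component V adj u. fst p = b}"
          using q b y Q_S S_add by (auto simp: component_def)
      next
        fix p assume "p \<in> {p \<in> component V adj u. fst p = b}"
        then have p: "reach V adj u p" "fst p = b" by (auto simp: component_def)
        obtain y1 q1 k1 where 1: "(b, cl y) = (b, cl y1)" "q1 \<in> Q" "k1 \<in> K"
            "x - y1 - (pot a - pot b) = q1 + k1" using inv[OF y(2)] by auto
        obtain y2 q2 k2 where 2: "p = (b, cl y2)" "q2 \<in> Q" "k2 \<in> K"
            "x - y2 - (pot a - pot b) = q2 + k2" using inv[OF p] by auto
        \<comment> \<open>Two points over the same \<open>b\<close> have the same potential term,
          which cancels.\<close>
        have "y2 - y1 - (q1 - q2) = k1 - k2" using 1(4) 2(4) by (simp add: algebra_simps)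
        then have *: "y2 - (y + (q1 - q2)) = k1 - k2 - (y - y1)" by (simp add: algebra_simps)
        have yy: "y - y1 \<in> K" using 1(1) by (metis cl_eq Pair_inject)
        have "y2 - (y + (q1 - q2)) \<in> K"
          unfolding * by (rule K_diff[OF K_diff[OF 1(3) 2(3)] yy])
        then have "p = (b, cl (y + (q1 - q2)))" using 2(1) by (simp add: cl_eq)
        then show "p \<in> (\<lambda>q. (b, cl (y + q))) ` Q" using Q_diff 1 2 by blast
      qed
    qed
    then have "Q \<approx> {p \<in> component V adj u. fst p = b}" by (auto simp: eqpoll_def)
    then show ?thesis using Qk eqpoll_sym eqpoll_trans by blast
  qed
  have "connected_graph (component V adj u) adj"
    using adj_sym u by (rule connected_graph_component)
  then show ?thesis
    unfolding k_fold_cover_def using conn fibre local_iso_component[OF local_iso_fst] by blast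
qed

end

section \<open>Linear algebra and the graph \<open>H\<^sub>3\<close>\<close>

lemma pair_commute: "pair f v = pair v f"
  by (simp add: pair_def mult.commute)

lemma pair_add [simp]: "pair f (v + w) = pair f v + pair f w" "pair (f + g) v = pair f v + pair g v"
  by (simp_all add: pair_def algebra_simps sum.distrib)

lemma pair_diff [simp]: "pair f (v - w) = pair f v - pair f w"
  by (simp add: pair_def algebra_simps sum_subtractf)

lemma pair_scale [simp]: "pair f (a *s v) = a * pair f v" "pair (a *s f) v = a * pair f v"
  by (simp_all add: pair_def algebra_simps sum_distrib_left)

lemma pair_zero [simp]: "pair f 0 = 0" "pair 0 v = 0"
  by (simp_all add: pair_def)

lemma pair_axis [simp]: "pair (axis i 1) v = v $ i" "pair f (axis i 1) = f $ i"
  by (simp_all add: pair_def axis_def if_distrib if_distribR cong: if_cong)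

text \<open>Take a linear map that kills a basis of the span and sends \<open>z\<close> to
  \<open>axis 0 1\<close>; its coordinate 0 is the functional.\<close>

lemma functional_separating:
  fixes z :: "'a::field ^ 4"
  assumes "z \<notin> vec.span B"
  obtains k where "\<And>b. b \<in> B \<Longrightarrow> pair k b = 0" "pair k z \<noteq> 0"
proof -
  obtain C where C: "C \<subseteq> B" "vec.independent C" "B \<subseteq> vec.span C"
    using vec.maximal_independent_subset by blast
  have zC: "z \<notin> vec.span C" using assms C(1) vec.span_mono by blast
  have "vec.independent (insert z C)" using C(2) zC by (simp add: vec.independent_insert)
  then obtain g :: "'a ^ 4 \<Rightarrow> 'a ^ 4" where g: "Vector_Spaces.linear (*s) (*s) g"
      "\<And>x. x \<in> insert z C \<Longrightarrow> g x = (if x = z then axis 0 1 else 0)"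
    using vec.linear_independent_extend[of "insert z C" "\<lambda>x. if x = z then axis 0 1 else 0"] by blast
  define k where "k = row 0 (matrix g)"
  have k: "pair k x = g x $ 0" for x
    using matrix_works[OF g(1), of x]
    by (auto simp: k_def pair_def row_def matrix_vector_mult_def vec_eq_iff)
  have "z \<notin> C" using zC vec.span_base by blast
  then have "pair k b = 0" if "b \<in> C" for b using g(2)[of b] that by (auto simp: k)
  then have "C \<subseteq> {x. pair k x = 0}" by auto
  moreover have "vec.subspace {x. pair k x = 0}" by (auto simp: vec.subspace_def)
  ultimately have "vec.span C \<subseteq> {x. pair k x = 0}" by (rule vec.span_minimal)
  then have "pair k b = 0" if "b \<in> B" for b using C(3) that by blast
  moreover have "pair k z \<noteq> 0" using g(2)[of z] by (simp add: k axis_def)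
  ultimately show thesis using that by blast
qed

text \<open>Three functionals do not span the dual space. Vectors and functionals share one type, so
  a functional that vanishes on \<open>h1\<close>, \<open>h2\<close>, \<open>h3\<close> can be read
  as the vector \<open>z\<close>.\<close>

lemma common_zero_of_three:
  fixes h1 h2 h3 :: "'a::field ^ 4"
  obtains z where "z \<noteq> 0" "pair h1 z = 0" "pair h2 z = 0" "pair h3 z = 0"
proof -
  have "card {h1, h2, h3} \<le> 3" by (simp add: card_insert_if)
  then have "vec.dim (vec.span {h1, h2, h3}) \<le> 3"
    using vec.dim_le_card[of "vec.span {h1, h2, h3}" "{h1, h2, h3}"] by simp
  moreover have "vec.dim (UNIV :: ('a ^ 4) set) = 4" by (simp only: vec.dim_UNIV card_cart_basis) simp
  ultimately have "vec.span {h1, h2, h3} \<noteq> UNIV" by (auto simp del: vec.dim_span)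
  then obtain e where "e \<notin> vec.span {h1, h2, h3}" by blast
  then obtain k where "\<And>b. b \<in> {h1, h2, h3} \<Longrightarrow> pair k b = 0" "pair k e \<noteq> 0"
    using functional_separating by blast
  then show thesis using that[of k] pair_commute[of _ k] by (metis insertCI pair_zero(2))
qed

text \<open>Geometrically, two point-plane pairs have a common neighbour. The point \<open>z\<close>
  has to lie in both planes but outside the span of \<open>v\<close> and \<open>w\<close>; a plane
  that contains this span and avoids \<open>z\<close> then exists.\<close>

lemma common_neighbour:
  fixes v w f g :: "'a::field ^ 4"
  assumes "pair f v \<noteq> 0" "pair g w \<noteq> 0"
  obtains z k where "pair f z = 0" "pair g z = 0" "pair k v = 0" "pair k w = 0" "pair k z \<noteq> 0"
proof -
  \<comment> \<open>\<open>u\<close> spans the part of the span of \<open>v\<close> and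
    \<open>w\<close> on which \<open>f\<close> vanishes. When \<open>u\<close> is nonzero, a
    functional \<open>m\<close> with \<open>m(u)\<close> nonzero keeps a nonzero common zero of
    \<open>f\<close> and \<open>m\<close> out of that span.\<close>
  define u where "u = w - (pair f w / pair f v) *s v"
  obtain m where m: "u \<noteq> 0 \<Longrightarrow> pair m u \<noteq> 0"
  proof (cases "u = 0")
    case False
    then have "u \<notin> vec.span {}" by simp
    then show ?thesis using functional_separating that by metis
  qed (use that in blast)
  obtain z where z: "z \<noteq> 0" "pair f z = 0" "pair g z = 0" "pair m z = 0"
    by (rule common_zero_of_three)
  have "z \<notin> vec.span {v, w}"
  proof
    assume "z \<in> vec.span {v, w}"
    then obtain a b where ab: "z = a *s v + b *s w"
      by (auto simp: vec.span_insert algebra_simps)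
    have "a = - b * (pair f w / pair f v)"
      using z(2) assms(1) unfolding ab by (simp add: field_simps add_eq_0_iff)
    then have zu: "z = b *s u" unfolding ab u_def by (simp add: vec_eq_iff algebra_simps)
    then have "b * pair m u = 0" using z(4) by simp
    then show False using zu z(1) m by auto
  qed
  then obtain k where "\<And>b. b \<in> {v, w} \<Longrightarrow> pair k b = 0" "pair k z \<noteq> 0"
    by (rule functional_separating) blast
  then show thesis using that z by auto
qed

text \<open>The space is the direct sum of the kernel of \<open>f\<close> and the line of
  \<open>v\<close>, and both sides agree on each summand.\<close>

lemma proportional_of_kernel:
  assumes "pair f v \<noteq> 0" and "\<And>z. pair f z = 0 \<Longrightarrow> pair g z = 0"
  shows "g = (pair g v / pair f v) *s f"
proof -
  have "pair g x = (pair g v / pair f v) * pair f x" for x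
  proof -
    have "pair g (x - (pair f x / pair f v) *s v) = 0" by (rule assms(2)) (simp add: assms(1))
    then show ?thesis by (simp add: field_simps)
  qed
  from this[of "axis _ 1"] show ?thesis by (simp add: vec_eq_iff)
qed

section \<open>Points, planes and rank one tensors\<close>

lemma pt_subset_pl: "pt v \<subseteq> pl f \<longleftrightarrow> pair f v = 0"
proof
  assume "pt v \<subseteq> pl f"
  moreover have "v \<in> pt v" unfolding pt_def by (rule CollectI, rule exI[of _ 1]) simp
  ultimately show "pair f v = 0" by (auto simp: pl_def)
qed (auto simp: pt_def pl_def)

lemma pt_scale: "a \<noteq> 0 \<Longrightarrow> pt (a *s v) = pt v"
proof -
  assume a: "a \<noteq> 0"
  have "b *s v = (b / a) *s (a *s v)" for b using a by (simp add: vec_eq_iff)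
  then show ?thesis unfolding pt_def by (metis (no_types, opaque_lifting) vector_smult_assoc)
qed

lemma pl_scale: "a \<noteq> 0 \<Longrightarrow> pl (a *s f) = pl f"
  by (simp add: pl_def)

lemma pt_eqD: "pt v = pt w \<Longrightarrow> v \<noteq> 0 \<Longrightarrow> \<exists>a. a \<noteq> 0 \<and> v = a *s w"
proof -
  assume eq: "pt v = pt w" and v: "v \<noteq> 0"
  have "v \<in> pt v" unfolding pt_def by (rule CollectI, rule exI[of _ 1]) simp
  then obtain a where "v = a *s w" using eq by (auto simp: pt_def)
  then show ?thesis using v by (intro exI[of _ a]) auto
qed

lemma pl_eqD:
  assumes "pl f = pl g" "pair f v \<noteq> 0"
  shows "\<exists>a. a \<noteq> 0 \<and> g = a *s f"
proof -
  have "pair f z = 0 \<longleftrightarrow> pair g z = 0" for z using assms(1) by (auto simp: pl_def)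
  then show ?thesis
    using proportional_of_kernel[OF assms(2), of g] assms(2) by (intro exI[of _ "pair g v / pair f v"]) auto
qed

lemma tensor_eqD:
  assumes eq: "tensor v f = tensor w g" and "pair g w \<noteq> 0"
  obtains a where "a \<noteq> 0" "v = a *s w" "f = inverse a *s g"
proof -
  have e: "v $ i * f $ j = w $ i * g $ j" for i j
    using fun_cong[OF fun_cong[OF eq], of i j] by (simp add: tensor_def)
  have g: "pair f w * v $ i = pair g w * w $ i" for i
  proof -
    have "(\<Sum>j\<in>UNIV. v $ i * f $ j * w $ j) = (\<Sum>j\<in>UNIV. w $ i * g $ j * w $ j)" by (simp add: e)
    then show ?thesis by (simp add: pair_def sum_distrib_left algebra_simps)
  qed
  have "w \<noteq> 0" using assms(2) by auto
  then obtain i where i: "w $ i \<noteq> 0" by (auto simp: vec_eq_iff)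
  have fw: "pair f w \<noteq> 0" using g[of i] i assms(2) by auto
  define a where "a = pair g w / pair f w"
  have a: "a \<noteq> 0" using fw assms(2) by (simp add: a_def)
  have v: "v = a *s w" using g fw by (simp add: vec_eq_iff a_def field_simps)
  moreover have "f = inverse a *s g"
  proof -
    have "a * w $ i * f $ j = w $ i * g $ j" for j using e[of i j] v by simp
    then show ?thesis using i a by (simp add: vec_eq_iff field_simps)
  qed
  ultimately show thesis using that a by blast
qed

lemma rep_tensor:
  assumes "pair f v \<noteq> 0"
  obtains a where "a \<noteq> 0" "rep (tensor v f) = (a *s v, inverse a *s f)"
proof -
  define vh where "vh = rep (tensor v f)"
  have "tensor v f = tensor (fst vh) (snd vh) \<and> pair (snd vh) (fst vh) \<noteq> 0"
    unfolding vh_def rep_def by (rule someI[of _ "(v, f)"]) (simp add: assms)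
  then obtain a where "a \<noteq> 0" "fst vh = a *s v" "snd vh = inverse a *s f"
    using tensor_eqD[of "fst vh" "snd vh" v f] assms by metis
  then show thesis using that by (simp add: vh_def prod_eq_iff)
qed

text \<open>\<open>rep\<close> is determined only up to inverse scalings of its two parts, which
  change neither the point nor the plane.\<close>

definition proj :: "(4 \<Rightarrow> 4 \<Rightarrow> 'a::field) \<Rightarrow> ('a ^ 4) set \<times> ('a ^ 4) set" where
  "proj T = (pt (fst (rep T)), pl (snd (rep T)))"

lemma proj_tensor: "pair f v \<noteq> 0 \<Longrightarrow> proj (tensor v f) = (pt v, pl f)"
  by (erule rep_tensor) (simp add: proj_def pt_scale pl_scale)

lemma H3_verts_alt: "H3_verts = {(pt v, pl f) | v f. pair f v \<noteq> 0}"
  unfolding H3_verts_def by (auto simp: pt_subset_pl) (metis pair_zero)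

lemma proj_Ht_verts: "proj ` Ht_verts = (H3_verts :: (('a::field ^ 4) set \<times> ('a ^ 4) set) set)"
proof -
  have "proj T \<in> H3_verts" if T: "T \<in> Ht_verts" for T :: "4 \<Rightarrow> 4 \<Rightarrow> 'a"
    using T unfolding Ht_verts_def H3_verts_alt by (auto simp: proj_tensor) blast
  moreover have "a \<in> proj ` Ht_verts" if "a \<in> H3_verts" for a :: "('a ^ 4) set \<times> ('a ^ 4) set"
  proof -
    obtain v f where "a = (pt v, pl f)" "pair f v \<noteq> 0" using \<open>a \<in> H3_verts\<close> unfolding H3_verts_alt by blast
    then show ?thesis
      by (intro image_eqI[of _ _ "tensor v f"]) (auto simp: proj_tensor Ht_verts_def)
  qed
  ultimately show ?thesis by blast
qed

lemma H3_adj_iff: "H3_adj (pt v, pl f) (pt w, pl g) \<longleftrightarrow> pair g v = 0 \<and> pair f w = 0"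
  by (simp add: H3_adj_def pt_subset_pl)

lemma Ht_adj_iff:
  assumes "T \<in> Ht_verts" "S \<in> Ht_verts"
  shows "Ht_adj T S \<longleftrightarrow> H3_adj (proj T) (proj S)"
proof
  assume "Ht_adj T S"
  then show "H3_adj (proj T) (proj S)" by (auto simp: Ht_adj_def proj_tensor H3_adj_iff)
next
  assume *: "H3_adj (proj T) (proj S)"
  obtain v f w g where "T = tensor v f" "pair f v \<noteq> 0" "S = tensor w g" "pair g w \<noteq> 0"
    using assms by (auto simp: Ht_verts_def)
  then show "Ht_adj T S" using * unfolding Ht_adj_def by (auto simp: proj_tensor H3_adj_iff)
qed

section \<open>Connectedness and neighbourhoods of the graph on point-plane pairs\<close>

lemma H3_adj_sym: "H3_adj a b \<Longrightarrow> H3_adj b a"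
  by (auto simp: H3_adj_def)

text \<open>By \<open>common_neighbour\<close> any two vertices are joined by a walk of length
  two.\<close>

lemma H3_connected: "connected_graph (H3_verts :: (('a::field ^ 4) set \<times> ('a ^ 4) set) set) H3_adj"
  unfolding connected_graph_def
proof (intro conjI ballI)
  have "(pt (axis 0 1), pl (axis 0 1)) \<in> (H3_verts :: (('a ^ 4) set \<times> ('a ^ 4) set) set)"
    unfolding H3_verts_alt by (intro CollectI exI[of _ "axis 0 1"]) simp
  then show "(H3_verts :: (('a ^ 4) set \<times> ('a ^ 4) set) set) \<noteq> {}" by blast
next
  fix a b :: "('a ^ 4) set \<times> ('a ^ 4) set"
  assume "a \<in> H3_verts" "b \<in> H3_verts"
  then obtain v f w g where a: "a = (pt v, pl f)" "pair f v \<noteq> 0" and b: "b = (pt w, pl g)" "pair g w \<noteq> 0"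
    unfolding H3_verts_alt by blast
  obtain z k where zk: "pair f z = 0" "pair g z = 0" "pair k v = 0" "pair k w = 0" "pair k z \<noteq> 0"
    using common_neighbour[OF a(2) b(2)] .
  have m: "(pt z, pl k) \<in> H3_verts" "a \<in> H3_verts" "b \<in> H3_verts"
    using zk a b unfolding H3_verts_alt by blast+
  have "H3_adj a (pt z, pl k)" "H3_adj (pt z, pl k) b" using zk a b by (auto simp: H3_adj_iff)
  then show "reach H3_verts H3_adj a b"
    using m by (intro reach_trans[of _ _ a "(pt z, pl k)" b] reach_edge)
qed

text \<open>Every nonzero \<open>z\<close> in the plane of \<open>a\<close> gives the point of some
  neighbour, so that plane lies in the plane of \<open>b\<close> and the two coincide. The dual
  argument, with vectors and functionals exchanged, handles the points.\<close>

lemma H3_nbhd_inj: "inj_on (nbhd H3_verts H3_adj) H3_verts"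
proof (rule inj_onI)
  fix a b :: "('a::field ^ 4) set \<times> ('a ^ 4) set"
  assume ab: "a \<in> H3_verts" "b \<in> H3_verts" and eq: "nbhd H3_verts H3_adj a = nbhd H3_verts H3_adj b"
  obtain v f w g where a: "a = (pt v, pl f)" "pair f v \<noteq> 0" and b: "b = (pt w, pl g)" "pair g w \<noteq> 0"
    using ab unfolding H3_verts_alt by blast
  have nb: "pair g z = 0 \<and> pair k w = 0" if "pair k z \<noteq> 0" "pair f z = 0" "pair k v = 0" for z k
  proof -
    have "(pt z, pl k) \<in> nbhd H3_verts H3_adj a"
      using that a unfolding nbhd_def H3_verts_alt by (auto simp: H3_adj_iff)
    then have "H3_adj b (pt z, pl k)" using eq by (auto simp: nbhd_def)
    then show ?thesis using b by (simp add: H3_adj_iff)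
  qed
  have sep: "\<exists>k. pair k x = 0 \<and> pair k y \<noteq> 0"
    if "y \<noteq> 0" "pair h y = 0" "pair h x \<noteq> 0" for x y h :: "'a ^ 4"
  proof -
    have "y \<notin> vec.span {x}"
    proof
      assume "y \<in> vec.span {x}"
      then obtain t where "y = t *s x" by (auto simp: vec.span_insert)
      then show False using that by auto
    qed
    then show ?thesis using functional_separating by (metis singletonI)
  qed
  have "pair g z = 0" if "pair f z = 0" for z
    using sep[of z f v] nb that a(2) by (cases "z = 0") auto
  then have g: "g = (pair g v / pair f v) *s f" by (rule proportional_of_kernel[OF a(2)])
  have "pair w k = 0" if "pair v k = 0" for k
  proof (cases "k = 0")
    case False
    then have "\<exists>y. pair y f = 0 \<and> pair y k \<noteq> 0"
      using that a(2) by (intro sep[of k v f]) (auto simp: pair_commute)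
    then obtain y where "pair f y = 0" "pair k y \<noteq> 0" by (metis pair_commute)
    then show ?thesis using nb[of k y] that by (simp add: pair_commute)
  qed simp
  then have w: "w = (pair w f / pair v f) *s v"
    using proportional_of_kernel[of v f w] a(2) by (simp add: pair_commute)
  have "pair g v / pair f v \<noteq> 0" "pair w f / pair v f \<noteq> 0"
    using g w b(2) by (metis pair_zero vec.scale_zero_left)+
  then have "pl g = pl f" "pt w = pt v" using g w pl_scale pt_scale by metis+
  then show "a = b" using a b by simp
qed

lemma H3_nbhd_nonempty:
  assumes "a \<in> H3_verts"
  shows "nbhd H3_verts H3_adj a \<noteq> {}"
proof -
  obtain v f where a: "a = (pt v, pl f)" "pair f v \<noteq> 0" using assms unfolding H3_verts_alt by blast
  obtain z k where "pair f z = 0" "pair k v = 0" "pair k z \<noteq> 0" using common_neighbour[OF a(2) a(2)] .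
  then have "(pt z, pl k) \<in> nbhd H3_verts H3_adj a"
    using a unfolding nbhd_def H3_verts_alt by (auto simp: H3_adj_iff)
  then show ?thesis by blast
qed

section \<open>Voltages in coordinates\<close>

lemma less_4: "(0::4) < 1" "(0::4) < 2" "(0::4) < 3" "(1::4) < 2" "(1::4) < 3" "(2::4) < 3"
  by (simp_all add: less_bit0_def bit0.Rep_0 bit0.Rep_1 bit0.Rep_numeral)

lemmas less_4_iff = less_4 less_4[THEN less_not_sym] less_irrefl

text \<open>The definitions use the indices 0 to 3; in this type the numeral 4 equals 0.\<close>

lemma UNIV_4_zero: "(UNIV :: 4 set) = {0, 1, 2, 3}"
  unfolding UNIV_4 by auto

lemma sum_4_zero: "sum h (UNIV :: 4 set) = h 0 + h 1 + h 2 + h 3"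
  unfolding UNIV_4_zero by (simp add: add.assoc)

lemma distinct_4_UNIV:
  assumes "distinct [i, j, k, l :: 4]"
  shows "UNIV = {i, j, k, l}"
proof -
  have "card {i, j, k, l} = card (UNIV :: 4 set)" using assms by simp
  then show ?thesis using card_subset_eq[of UNIV "{i, j, k, l}"] by auto
qed

lemma forall_4_zero: "(\<forall>i::4. R i) \<longleftrightarrow> R 0 \<and> R 1 \<and> R 2 \<and> R 3"
proof -
  have four: "(4::4) = 0" by simp
  show ?thesis unfolding forall_4 four by blast
qed

lemma sum_distinct_4:
  fixes h :: "4 \<Rightarrow> 'b::comm_monoid_add"
  assumes "distinct [i, j, k, l]"
  shows "sum h UNIV = h i + h j + h k + h l"
  unfolding distinct_4_UNIV[OF assms] using assms by (auto simp: add.assoc)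

lemma upper_iff:
  "upper P \<longleftrightarrow> P \<in> {(0, 1), (0, 2), (0, 3), (1, 2), (1, 3), (2, 3)}"
proof -
  obtain i j where P: "P = (i, j)" by force
  have "\<forall>i j. upper (i, j) \<longleftrightarrow> (i, j) \<in> {(0, 1), (0, 2), (0, 3), (1, 2), (1, 3), (2, 3)}"
    unfolding upper_def by (simp add: forall_4_zero less_4_iff)
  then show ?thesis unfolding P by blast
qed

lemma upper_cases:
  assumes "upper P"
  obtains "P = (0, 1)" | "P = (0, 2)" | "P = (0, 3)" | "P = (1, 2)" | "P = (1, 3)" | "P = (2, 3)"
  using assms unfolding upper_iff by blast

lemma wedge_Wset: "wedge v w \<in> Wset"
  by (simp add: Wset_def wedge_def)

lemma s2add_plus: "s2add s t = s + t"
  by (simp add: s2add_def fun_eq_iff)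

lemma s2sub_minus: "s2sub s t = s - t"
  by (simp add: s2sub_def fun_eq_iff)

lemma s2zero_zero: "s2zero = 0"
  by (simp add: s2zero_def fun_eq_iff)

lemma axis_index: "axis i x $ j = (if j = i then x else 0)"
  by (simp add: axis_def)

locale char2_field =
  fixes c :: "'a::field"
  assumes char2: "CHAR('a) = 2" and c_nz: "c \<noteq> 0"
begin

section \<open>Arithmetic in characteristic 2\<close>

lemma add_self: "x + x = (0::'a)"
proof -
  have "(2::'a) = 0" using of_nat_CHAR[where 'a = 'a] char2 by simp
  then show ?thesis by (metis mult_2 mult_zero_left)
qed

lemma add_self_left: "x + (x + y) = (y::'a)"
  by (simp add: add.assoc[symmetric] add_self)

lemma minus_self: "- x = (x::'a)"
  by (rule minus_unique) (rule add_self)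

lemma diff_plus: "x - y = x + (y::'a)"
  using minus_self[of y] by (metis diff_conv_add_uminus)

lemma eq_iff_add_zero: "x = y \<longleftrightarrow> x + y = (0::'a)"
  by (metis add_self add_eq_0_iff minus_self)

text \<open>Decides identities between polynomials with coefficients in the field of two elements:
  ordered rewriting makes equal monomials adjacent, where they cancel.\<close>
lemmas char2_simps = diff_plus minus_self algebra_simps add_self add_self_left

lemma s2_add_self: "x + x = (0 :: 4 \<times> 4 \<Rightarrow> 4 \<times> 4 \<Rightarrow> 'a)"
  by (intro ext) (simp only: plus_fun_apply zero_fun_apply add_self)

lemma s2_minus_self: "- x = (x :: 4 \<times> 4 \<Rightarrow> 4 \<times> 4 \<Rightarrow> 'a)"
  by (rule minus_unique) (rule s2_add_self)

lemma s2_diff_plus: "x - y = x + (y :: 4 \<times> 4 \<Rightarrow> 4 \<times> 4 \<Rightarrow> 'a)"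
  by (simp add: fun_eq_iff diff_plus)

lemma wedge_plus: "wedge v w i j = v $ i * w $ j + v $ j * (w $ i :: 'a)"
  by (simp add: wedge_def diff_plus)

lemma Wset_sym: "eta \<in> Wset \<Longrightarrow> eta i j = (eta j i :: 'a)"
  unfolding Wset_def using minus_self by (metis (mono_tags, lifting) mem_Collect_eq)

text \<open>The star operator in the standard basis: each entry moves to the complementary pair of
  indices, without signs in characteristic 2. For \<open>i \<noteq> j\<close> the double sum has a
  single surviving term.\<close>

definition hodge :: "(4 \<Rightarrow> 4 \<Rightarrow> 'a) \<Rightarrow> 4 \<Rightarrow> 4 \<Rightarrow> 'a" where
  "hodge eta i j = (if i = j then 0
     else \<Sum>k\<in>UNIV. \<Sum>l\<in>UNIV. if k < l \<and> distinct [i, j, k, l] then eta k l else 0)"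

lemma hodge_entry:
  assumes "distinct [i, j, k, l]" "eta \<in> Wset"
  shows "hodge eta i j = eta k l"
proof -
  have *: "(if k < l then eta k l else 0) + (if l < k then eta l k else 0) = eta k l"
    using assms Wset_sym[OF assms(2), of k l] by (cases k l rule: linorder_cases) auto
  then show ?thesis
    using assms(1) unfolding hodge_def by (simp add: sum_distinct_4[OF assms(1)] eq_commute)
qed

lemma hodge_diag [simp]: "hodge eta i i = 0"
  by (simp add: hodge_def)

lemma ex_distinct_4:
  assumes "i \<noteq> (j::4)"
  obtains k l where "distinct [i, j, k, l]"
proof -
  have "card (UNIV - {i, j}) = 2" using assms by (simp add: card_Diff_subset)
  then obtain k l where "UNIV - {i, j} = {k, l}" "k \<noteq> l" by (auto simp: card_2_iff)
  then have "distinct [i, j, k, l]" using assms by auto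
  then show thesis using that by blast
qed

lemma phi_eq:
  assumes eta: "eta \<in> Wset"
  shows "phi c eta = (\<lambda>i j. hodge eta i j / c)"
  unfolding phi_def
proof (rule the_equality)
  have sym: "hodge eta i j = hodge eta j i" for i j
  proof (cases "i = j")
    case False
    then obtain k l where "distinct [i, j, k, l]" by (rule ex_distinct_4)
    then show ?thesis using hodge_entry[of i j k l] hodge_entry[of j i k l] eta by auto
  qed simp
  have "hodge eta 0 1 = eta 2 3" "hodge eta 0 2 = eta 1 3" "hodge eta 0 3 = eta 1 2"
    "hodge eta 1 2 = eta 0 3" "hodge eta 1 3 = eta 0 2" "hodge eta 2 3 = eta 0 1"
    by (rule hodge_entry; simp add: eta)+
  note h = this
  show "(\<lambda>i j. hodge eta i j / c) \<in> Wset \<and>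
      (\<forall>v\<in>Wset. chiW c v (\<lambda>i j. hodge eta i j / c) = evalW eta v)"
  proof (intro conjI ballI)
    show "(\<lambda>i j. hodge eta i j / c) \<in> Wset" using sym by (auto simp: Wset_def minus_self)
    fix v :: "4 \<Rightarrow> 4 \<Rightarrow> 'a"
    show "chiW c v (\<lambda>i j. hodge eta i j / c) = evalW eta v"
      using c_nz unfolding chiW_def evalW_def h
      by (simp add: sum_4_zero less_4_iff diff_plus field_simps)
  qed
  fix w assume w: "w \<in> Wset \<and> (\<forall>v\<in>Wset. chiW c v w = evalW eta v)"
  \<comment> \<open>For uniqueness it suffices to test the defining equation on the six basis
    bivectors.\<close>
  have e: "chiW c (wedge (axis i 1) (axis j 1)) w = evalW eta (wedge (axis i 1) (axis j 1))" for i j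
    using w wedge_Wset by blast
  have "c * w 2 3 = eta 0 1" "c * w 1 3 = eta 0 2" "c * w 1 2 = eta 0 3"
    "c * w 0 3 = eta 1 2" "c * w 0 2 = eta 1 3" "c * w 0 1 = eta 2 3"
    using e[of 0 1] e[of 0 2] e[of 0 3] e[of 1 2] e[of 1 3] e[of 2 3]
    by (simp_all add: chiW_def evalW_def wedge_def axis_index sum_4_zero less_4_iff minus_self)
  then have up: "w i j = hodge eta i j / c" if "upper (i, j)" for i j
    using that c_nz h by (auto simp: upper_iff field_simps)
  have wii: "w i i = 0" for i using w unfolding Wset_def by blast
  show "w = (\<lambda>i j. hodge eta i j / c)"
  proof (intro ext)
    fix i j
    show "w i j = hodge eta i j / c"
    proof (cases i j rule: linorder_cases)
      case less
      then show ?thesis using up by (simp add: upper_def)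
    next
      case equal
      then show ?thesis using wii by simp
    next
      case greater
      then show ?thesis using up[of j i] sym[of i j] w Wset_sym[of w i j] by (simp add: upper_def)
    qed
  qed
qed

lemma phi_entry:
  "distinct [i, j, k, l] \<Longrightarrow> phi c (wedge f g) i j = wedge f g k l / c"
  by (simp add: phi_eq wedge_Wset hodge_entry)

text \<open>\<open>U\<close> in coordinates: \<open>1 / c\<close> times the sum of the three
  products of complementary basis bivectors.\<close>

definition U0 :: "4 \<times> 4 \<Rightarrow> 4 \<times> 4 \<Rightarrow> 'a" where
  "U0 = (\<lambda>P Q. if upper P \<and> upper Q \<and> distinct [fst P, snd P, fst Q, snd Q] then 1 / c else 0)"

lemma U0_S2set: "U0 \<in> S2set"
  by (auto simp: U0_def S2set_def)

lemma symprod_S2set: "symprod p q \<in> S2set"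
  by (auto simp: symprod_def S2set_def)

lemma U_coordinates:
  assumes "chiW c (wedge w x) (wedge y z) = 1"
  shows "s2add (s2add (symprod (wedge w x) (wedge y z)) (symprod (wedge w y) (wedge z x)))
           (symprod (wedge w z) (wedge x y)) = U0" (is "?U = _")
proof (intro ext)
  fix P Q
  \<comment> \<open>\<open>E i j k l\<close> is the Laplace expansion, along two rows, of the
    determinant formed by the coordinates \<open>i\<close>, \<open>j\<close>, \<open>k\<close>,
    \<open>l\<close> of \<open>w\<close>, \<open>x\<close>, \<open>y\<close>, \<open>z\<close>. It
    vanishes at a repeated index; otherwise it is \<open>1 / c\<close>, by the normalisation of
    \<open>chiW\<close>.\<close>
  define E where "E i j k l = wedge w x i j * wedge y z k l + wedge w x k l * wedge y z i j
    + (wedge w y i j * wedge z x k l + wedge w y k l * wedge z x i j)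
    + (wedge w z i j * wedge x y k l + wedge w z k l * wedge x y i j)" for i j k l
  have swap: "E i j k l = E j i k l" "E i j k l = E i j l k" "E i j k l = E k l i j" for i j k l
    by (simp_all add: E_def wedge_plus ac_simps)
  have share: "E i j i l = 0" for i j l
    unfolding E_def wedge_def by algebra
  have "c * E 0 1 2 3 = chiW c (wedge w x) (wedge y z)"
    "c * E 0 2 1 3 = - chiW c (wedge w x) (wedge y z)"
    "c * E 0 3 1 2 = chiW c (wedge w x) (wedge y z)"
    unfolding E_def chiW_def wedge_def by algebra+
  then have disj: "c * E 0 1 2 3 = 1" "c * E 0 2 1 3 = 1" "c * E 0 3 1 2 = 1"
    using assms by (simp_all add: minus_self)
  have disj': "E 0 1 2 3 = 1 / c" "E 0 2 1 3 = 1 / c" "E 0 3 1 2 = 1 / c"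
    using disj c_nz by (simp_all add: field_simps)
  show "?U P Q = U0 P Q"
  proof (cases "upper P \<and> upper Q")
    case False
    then show ?thesis by (auto simp: U0_def s2add_def symprod_def)
  next
    case upper: True
    show ?thesis
    proof (cases "P = Q")
      case True
      \<comment> \<open>On the diagonal the sum is the Pluecker relation among the minors of four
        vectors in two coordinates.\<close>
      then show ?thesis
        using upper by (simp add: U0_def s2add_def symprod_def wedge_plus char2_simps)
    next
      case False
      have "?U P Q = E (fst P) (snd P) (fst Q) (snd Q)"
        using upper False by (simp add: s2add_def symprod_def E_def)
      moreover have "E (fst P) (snd P) (fst Q) (snd Q) = U0 P Q"
      proof (cases "distinct [fst P, snd P, fst Q, snd Q]")
        case True
        then have "(P, Q) \<in> {((0,1),(2,3)), ((0,2),(1,3)), ((0,3),(1,2)),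
            ((2,3),(0,1)), ((1,3),(0,2)), ((1,2),(0,3))}"
          by - (rule upper_cases[OF conjunct1[OF upper]]; rule upper_cases[OF conjunct2[OF upper]]; simp)
        then show ?thesis
          using disj' swap(3)[of 2 3 0 1] swap(3)[of 1 3 0 2] swap(3)[of 1 2 0 3] True upper
          by (auto simp: U0_def)
      next
        case False
        then have "fst P = fst Q \<or> fst P = snd Q \<or> snd P = fst Q \<or> snd P = snd Q"
          using upper unfolding upper_iff by auto
        then have "E (fst P) (snd P) (fst Q) (snd Q) = 0"
          using share swap by metis
        then show ?thesis using False by (auto simp: U0_def)
      qed
      ultimately show ?thesis by simp
    qed
  qed
qed

text \<open>Every admissible quadruple gives \<open>U0\<close>, so the choice made in
  \<open>UU\<close> does not matter. The factor \<open>1 / c\<close> in the witness normalises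
  \<open>chiW\<close> to 1.\<close>

lemma UU_eq: "UU c = U0"
proof -
  have "chiW c (wedge (axis 0 (1 / c)) (axis 1 1)) (wedge (axis 2 1) (axis 3 1)) = 1"
    using c_nz by (simp add: chiW_def wedge_def axis_index)
  then have "\<exists>u w x y z. chiW c (wedge w x) (wedge y z) = 1 \<and>
      u = s2add (s2add (symprod (wedge w x) (wedge y z)) (symprod (wedge w y) (wedge z x)))
                (symprod (wedge w z) (wedge x y))" by blast
  from someI_ex[OF this] show ?thesis unfolding UU_def[symmetric] using U_coordinates by auto
qed

section \<open>Scaling, skewness, potential and triangles of the voltage\<close>

lemma volt_S2set: "volt c v f w g \<in> S2set"
  using symprod_S2set[of "wedge v w" "phi c (wedge f g)"]
  by (auto simp: volt_def s2scale_def S2set_def)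

text \<open>The bivectors contribute the factor \<open>a * d * b * e\<close>, which the inverse
  pairings cancel. Hence the voltage depends only on points and planes.\<close>

lemma volt_scale:
  assumes "a \<noteq> 0" "b \<noteq> 0" "d \<noteq> 0" "e \<noteq> 0"
  shows "volt c (a *s v) (b *s f) (d *s w) (e *s g) = volt c v f w g"
proof -
  have w: "wedge (a *s v) (d *s w) = (\<lambda>i j. a * d * wedge v w i j)" for a d and v w :: "'a ^ 4"
    by (simp add: wedge_def fun_eq_iff algebra_simps)
  have h: "hodge (\<lambda>i j. t * eta i j) i j = t * hodge eta i j" for t eta i j
    by (simp add: hodge_def sum_distrib_left if_distrib cong: if_cong)
  have sp: "symprod (\<lambda>i j. s * p i j) (\<lambda>i j. t * q i j) = s2scale (s * t) (symprod p q)"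
    for s t and p q :: "4 \<Rightarrow> 4 \<Rightarrow> 'a"
    by (simp add: symprod_def s2scale_def fun_eq_iff algebra_simps)
  have ss: "s2scale s (s2scale t p) = s2scale (s * t) p" for s t and p :: "4 \<times> 4 \<Rightarrow> 4 \<times> 4 \<Rightarrow> 'a"
    by (simp add: s2scale_def fun_eq_iff algebra_simps)
  have p: "phi c (wedge (b *s f) (e *s g)) = (\<lambda>i j. b * e * phi c (wedge f g) i j)"
    using phi_eq[OF wedge_Wset, of f g] phi_eq[OF wedge_Wset, of "b *s f" "e *s g"]
    by (simp add: w h)
  show ?thesis
    unfolding volt_def p unfolding w sp ss
    by (rule arg_cong[where f = "\<lambda>t. s2scale t _"])
      (cases "pair f v = 0"; cases "pair g w = 0"; use assms in \<open>simp add: field_simps\<close>)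
qed

lemma volt_skew: "volt c w g v f = - volt c v f w g"
proof -
  have "wedge w v = wedge v w" for v w :: "'a ^ 4"
    by (simp add: fun_eq_iff wedge_plus ac_simps)
  then show ?thesis by (simp add: volt_def s2_minus_self mult.commute)
qed

text \<open>The off-diagonal part of the map \<open>\<rho>\<close> at \<open>T = v \<otimes> f\<close> with \<open>f(v) = 1\<close>.
  A pair of bivectors \<open>e\<^sub>i \<and> e\<^sub>j\<close>, \<open>e\<^sub>i \<and> e\<^sub>k\<close> picks out the matrix entry
  \<open>T\<^sub>i\<^sub>l\<close>, where \<open>l\<close> is the missing index. A complementary pair picks out a sum
  of two diagonal entries; the choice of the one that contains \<open>T\<^sub>0\<^sub>0\<close> is arbitrary, since
  the trace is 1 and the other sum differs by 1, that is, by \<open>U\<close>.\<close>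
definition pot :: "'a ^ 4 \<Rightarrow> 'a ^ 4 \<Rightarrow> 4 \<times> 4 \<Rightarrow> 4 \<times> 4 \<Rightarrow> 'a" where
  "pot v f = (\<lambda>P Q. if upper P \<and> upper Q \<and> P \<noteq> Q then
     (if distinct [fst P, snd P, fst Q, snd Q]
      then (if fst P = 0 then v $ 0 * f $ 0 + v $ snd P * f $ snd P
            else v $ 0 * f $ 0 + v $ snd Q * f $ snd Q)
      else (\<Sum>i\<in>{fst P, snd P} \<inter> {fst Q, snd Q}. \<Sum>l\<in>UNIV - {fst P, snd P, fst Q, snd Q}. v $ i * f $ l))
     / c else 0)"

text \<open>An off-diagonal coefficient at upper pairs is \<open>1 / c\<close> times a sum of two
  products of minors of \<open>(v, w)\<close> and \<open>(f, g)\<close>. Contraction identities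
  reduce it to entries of the two idempotents and the constant recorded by
  \<open>U0\<close>.\<close>

lemma volt_potential:
  assumes "pair f v = 1" "pair g w = 1" "pair f w = 0" "pair g v = 0" and "P \<noteq> Q"
  shows "volt c v f w g P Q = pot v f P Q + pot w g P Q + U0 P Q"
proof -
  define M where "M i j k l = wedge v w i j * wedge f g k l" for i j k l
  have M_swap: "M i j k l = M j i k l" "M i j k l = M i j l k" for i j k l
    by (simp_all add: M_def wedge_plus ac_simps)
  \<comment> \<open>This is entry \<open>(i, l)\<close> of the matrix product of
    \<open>wedge v w\<close> and \<open>wedge f g\<close>: the middle indices \<open>i\<close> and
    \<open>l\<close> contribute nothing, and the pairings evaluate the sum.\<close>
  have share: "M i j j l + M i k k l = v $ i * f $ l + w $ i * g $ l"
    if "distinct [i, j, k, l]" for i j k l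
  proof -
    have "M i j j l + M i k k l =
      v $ i * f $ l * pair g w + w $ i * g $ l * pair f v + v $ i * g $ l * pair f w + w $ i * f $ l * pair g v"
      by (subst eq_iff_add_zero)
        (simp add: M_def pair_def sum_distinct_4[OF that] wedge_plus char2_simps)
    then show ?thesis using assms by simp
  qed
  \<comment> \<open>By Cauchy-Binet all six products of minors sum to the Gram determinant 1. In
    characteristic 2 the contracted diagonal entries at \<open>i\<close> and \<open>j\<close>
    account for the four pairs other than \<open>{i, j}\<close> and \<open>{k, l}\<close>. The
    constant 1 is the source of \<open>U0\<close>.\<close>
  have disj: "M i j i j + M k l k l = v $ i * f $ i + v $ j * f $ j + (w $ i * g $ i + w $ j * g $ j) + 1"
    if "distinct [i, j, k, l]" for i j k l
  proof -
    have "M i j i j + M k l k l =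
      (v $ i * f $ i + v $ j * f $ j) * pair g w + (w $ i * g $ i + w $ j * g $ j) * pair f v
        + (v $ i * g $ i + v $ j * g $ j) * pair f w + (w $ i * f $ i + w $ j * f $ j) * pair g v
        + (pair f v * pair g w + pair f w * pair g v)"
      by (subst eq_iff_add_zero)
        (simp add: M_def pair_def sum_distinct_4[OF that] wedge_plus char2_simps)
    then show ?thesis using assms by simp
  qed
  have phi_sym: "phi c (wedge f g) i j = phi c (wedge f g) j i" for i j
  proof (cases "i = j")
    case False
    then obtain k l where "distinct [i, j, k, l]" by (rule ex_distinct_4)
    then show ?thesis using phi_entry[of i j k l] phi_entry[of j i k l] by auto
  qed simp
  have wedge_sym: "wedge v w i j = wedge v w j i" for i j
    by (simp add: wedge_plus ac_simps)
  show ?thesis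
  proof (cases "upper P \<and> upper Q")
    case False
    then show ?thesis by (auto simp: volt_def s2scale_def symprod_def pot_def U0_def)
  next
    case upper: True
    obtain i j k l where PQ: "P = (i, j)" "Q = (k, l)" by force
    have ne: "i \<noteq> j" "k \<noteq> l" using upper PQ by (auto simp: upper_def)
    have volt: "volt c v f w g P Q = wedge v w i j * phi c (wedge f g) k l + wedge v w k l * phi c (wedge f g) i j"
      using upper assms PQ by (auto simp: volt_def s2scale_def symprod_def)
    show ?thesis
    proof (cases "distinct [i, j, k, l]")
      case True
      then have kl: "distinct [k, l, i, j]" by auto
      have volt': "volt c v f w g P Q = (M i j i j + M k l k l) / c"
        unfolding volt phi_entry[OF True] phi_entry[OF kl] by (simp add: M_def add_divide_distrib)
      \<comment> \<open>One of two complementary pairs contains 0, necessarily as its smaller index,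
        and \<open>pot\<close> selects that pair.\<close>
      have ik: "i = 0 \<or> k = 0"
        using upper True unfolding PQ
        by (elim conjE upper_cases[of "(i, j)"] upper_cases[of "(k, l)"]) simp_all
      have pot: "pot x h P Q =
          (if i = 0 then x $ i * h $ i + x $ j * h $ j else x $ 0 * h $ 0 + x $ l * h $ l) / c" for x h
        using upper True PQ by (simp add: pot_def)
      have U: "U0 P Q = 1 / c" using upper True PQ by (simp add: U0_def)
      show ?thesis
      proof (cases "i = 0")
        case True
        then show ?thesis
          unfolding volt' pot U disj[OF \<open>distinct [i, j, k, l]\<close>] by (simp add: add_divide_distrib)
      next
        case False
        then show ?thesis
          using ik unfolding volt' pot U add.commute[of "M i j i j"] disj[OF kl]
          by (simp add: add_divide_distrib)
      qed
    next
      case False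
      \<comment> \<open>\<open>a\<close> is the shared index and \<open>e\<close> below is the
        missing one; the potential has only the entry \<open>(a, e)\<close> here.\<close>
      then obtain a b d where abd: "{i, j} = {a, b}" "{k, l} = {a, d}" "a \<noteq> b" "a \<noteq> d"
      proof -
        have "i = k \<or> i = l \<or> j = k \<or> j = l" using False ne by auto
        then show thesis
          using that[of i j l] that[of i j k] that[of j i l] that[of j i k] ne
          by (elim disjE) (simp_all add: insert_commute)
      qed
      have "b \<noteq> d"
      proof
        assume "b = d"
        then have "{i, j} = {k, l}" using abd by simp
        then show False using upper assms(5) PQ by (auto simp: doubleton_eq_iff upper_def)
      qed
      moreover obtain e where "e \<notin> {a, b, d}"
      proof -
        have "card {a, b, d} < card (UNIV :: 4 set)" by (simp add: card_insert_if)
        then have "{a, b, d} \<noteq> UNIV" by auto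
        then show thesis using that by auto
      qed
      ultimately have e: "distinct [a, b, d, e]" using abd by auto
      then have e': "distinct [a, b, d, e]" "distinct [a, d, b, e]" by auto
      have "UNIV - {i, j, k, l} = {e}"
      proof -
        have "{i, j, k, l} = {a, b, d}" using abd by blast
        then show ?thesis using distinct_4_UNIV[OF e] e by auto
      qed
      moreover have "{i, j} \<inter> {k, l} = {a}" using abd e by auto
      ultimately have pot: "pot x h P Q = x $ a * h $ e / c" for x h
        using upper PQ False assms(5) by (auto simp: pot_def)
      have "wedge v w i j = wedge v w a b" "phi c (wedge f g) i j = phi c (wedge f g) a b"
        "wedge v w k l = wedge v w a d" "phi c (wedge f g) k l = phi c (wedge f g) a d"
        using abd(1,2) wedge_sym phi_sym by (auto simp: doubleton_eq_iff)
      moreover have "phi c (wedge f g) a b = wedge f g d e / c" "phi c (wedge f g) a d = wedge f g b e / c"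
        using e by (auto intro: phi_entry)
      ultimately have "volt c v f w g P Q = (M a b b e + M a d d e) / c"
        unfolding volt by (simp add: M_def add_divide_distrib)
      moreover have "U0 P Q = 0" using False PQ by (auto simp: U0_def)
      ultimately show ?thesis
        using share[OF e] by (simp add: pot add_divide_distrib)
    qed
  qed
qed

text \<open>The three tensors are orthogonal idempotents of rank one, so the identity minus their
  sum has rank one. Its factors are a common zero \<open>x\<close> of the functionals and a
  functional \<open>y\<close> dual to \<open>x\<close>.\<close>

lemma rank_one_complement:
  fixes v1 v2 v3 f1 f2 f3 :: "'a ^ 4"
  assumes "pair f1 v1 = 1" "pair f2 v2 = 1" "pair f3 v3 = 1"
    and "pair f1 v2 = 0" "pair f1 v3 = 0" "pair f2 v1 = 0" "pair f2 v3 = 0"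
      "pair f3 v1 = 0" "pair f3 v2 = 0"
  obtains x y :: "'a ^ 4"
  where "\<And>i j. v1 $ i * f1 $ j + v2 $ i * f2 $ j + v3 $ i * f3 $ j + x $ i * y $ j = (if i = j then 1 else 0)"
proof -
  obtain x where x: "x \<noteq> 0" "pair f1 x = 0" "pair f2 x = 0" "pair f3 x = 0"
    by (rule common_zero_of_three)
  have "x \<notin> vec.span {v1, v2, v3}"
  proof
    assume "x \<in> vec.span {v1, v2, v3}"
    then obtain a b d where abd: "x = a *s v1 + b *s v2 + d *s v3"
      by (auto simp: vec.span_insert algebra_simps)
    then have "a = 0" "b = 0" "d = 0" using x(2-4) assms by auto
    then show False using x(1) abd by simp
  qed
  then obtain y' where y': "\<And>u. u \<in> {v1, v2, v3} \<Longrightarrow> pair y' u = 0" "pair y' x \<noteq> 0"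
    by (rule functional_separating) blast
  define y where "y = inverse (pair y' x) *s y'"
  have y: "pair y v1 = 0" "pair y v2 = 0" "pair y v3 = 0" "pair y x = 1"
    using y' by (auto simp: y_def)
  define sel :: "4 \<Rightarrow> 'a^4 \<Rightarrow> 'a^4 \<Rightarrow> 'a^4 \<Rightarrow> 'a^4 \<Rightarrow> 'a^4" where
    "sel a p q r s = (if a = 0 then p else if a = 1 then q else if a = 2 then r else s)" for a p q r s
  \<comment> \<open>The columns of \<open>A\<close> and the rows of \<open>B\<close> are dual bases.
    The left inverse \<open>B\<close> is also a right inverse, and that equation is the claimed
    expansion of the identity.\<close>
  define A :: "'a ^ 4 ^ 4" where "A = (\<chi> i a. sel a v1 v2 v3 x $ i)"
  define B :: "'a ^ 4 ^ 4" where "B = (\<chi> a j. sel a f1 f2 f3 y $ j)"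
  have "(B ** A) $ a $ b = pair (sel a f1 f2 f3 y) (sel b v1 v2 v3 x)" for a b
    by (simp add: matrix_matrix_mult_def A_def B_def pair_def)
  then have "B ** A = mat 1"
    using assms x y by (simp add: vec_eq_iff mat_def sel_def forall_4_zero)
  then have AB: "A ** B = mat 1" by (simp add: matrix_left_right_inverse)
  have "v1 $ i * f1 $ j + v2 $ i * f2 $ j + v3 $ i * f3 $ j + x $ i * y $ j = (A ** B) $ i $ j" for i j
    by (simp add: matrix_matrix_mult_def A_def B_def sel_def sum_4_zero)
  also have "(A ** B) $ i $ j = (if i = j then 1 else 0)" for i j
    unfolding AB by (simp add: mat_def)
  finally show thesis by (rule that)
qed

text \<open>Off the diagonal each potential occurs twice and cancels, and three copies of
  \<open>U0\<close> leave one. On the diagonal the sum is \<open>1 / c\<close> times a minor of the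
  sum of the three idempotents, with disjoint row and column indices.\<close>

lemma volt_triangle:
  assumes v: "pair f1 v1 = 1" "pair f2 v2 = 1" "pair f3 v3 = 1"
    and o: "pair f1 v2 = 0" "pair f1 v3 = 0" "pair f2 v1 = 0" "pair f2 v3 = 0"
      "pair f3 v1 = 0" "pair f3 v2 = 0"
  shows "volt c v1 f1 v2 f2 + volt c v2 f2 v3 f3 + volt c v3 f3 v1 f1 = U0"
proof (intro ext)
  fix P Q
  show "(volt c v1 f1 v2 f2 + volt c v2 f2 v3 f3 + volt c v3 f3 v1 f1) P Q = U0 P Q"
  proof (cases "P = Q")
    case False
    then show ?thesis
      using v o by (simp add: volt_potential char2_simps)
  next
    case True
    show ?thesis
    proof (cases "upper P")
      case False
      then show ?thesis by (simp add: volt_def s2scale_def symprod_def U0_def)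
    next
      case upper: True
      obtain i j where P: "P = (i, j)" by force
      have "i \<noteq> j" using upper P by (auto simp: upper_def)
      then obtain k l where ijkl: "distinct [i, j, k, l]" by (rule ex_distinct_4)
      obtain x y :: "'a ^ 4" where xy: "\<And>i j. v1 $ i * f1 $ j + v2 $ i * f2 $ j + v3 $ i * f3 $ j + x $ i * y $ j
          = (if i = j then 1 else 0)"
        using rank_one_complement[OF v o] by blast
      define M where "M i j = v1 $ i * f1 $ j + v2 $ i * f2 $ j + v3 $ i * f3 $ j" for i j
      \<comment> \<open>Away from its diagonal the sum agrees with a rank one matrix, whose two by
        two minors vanish.\<close>
      have M: "M p q = x $ p * y $ q" if "p \<noteq> q" for p q
        by (subst eq_iff_add_zero) (use xy[of p q] that in \<open>simp add: M_def\<close>)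
      have "volt c v f w g P P = wedge v w i j * wedge f g k l / c"
        if "pair f v = 1" "pair g w = 1" for v w f g
        using that upper phi_entry[OF ijkl] by (simp add: volt_def s2scale_def symprod_def P)
      then have "(volt c v1 f1 v2 f2 + volt c v2 f2 v3 f3 + volt c v3 f3 v1 f1) P P =
        (wedge v1 v2 i j * wedge f1 f2 k l + wedge v2 v3 i j * wedge f2 f3 k l
          + wedge v3 v1 i j * wedge f3 f1 k l) / c"
        using v by (simp add: add_divide_distrib)
      also have "wedge v1 v2 i j * wedge f1 f2 k l + wedge v2 v3 i j * wedge f2 f3 k l
          + wedge v3 v1 i j * wedge f3 f1 k l = M i k * M j l - M i l * M j k"
        unfolding M_def wedge_def by algebra
      also have "\<dots> = 0" using ijkl by (simp add: M)
      finally show ?thesis using True by (simp add: U0_def)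
    qed
  qed
qed

text \<open>For an upper pair \<open>R\<close> this is \<open>a\<close> times the square of the
  basis bivector at \<open>R\<close>.\<close>

definition single :: "4 \<times> 4 \<Rightarrow> 'a \<Rightarrow> 4 \<times> 4 \<Rightarrow> 4 \<times> 4 \<Rightarrow> 'a" where
  "single R a = (\<lambda>P Q. if P = R \<and> Q = R then a else 0)"

text \<open>All four darts have the points \<open>e i\<close> and \<open>e j\<close>, so they share
  the first factor and the second factors add up to the image under \<open>phi\<close> of the wedge
  of \<open>e i + f\<close> and \<open>e j + g\<close>, that is, of \<open>c * a\<close> times the
  wedge of \<open>e k\<close> and \<open>e l\<close>. The factor \<open>c\<close> in
  \<open>f\<close> cancels the \<open>1 / c\<close> in \<open>phi\<close>.\<close>

lemma volt_four_cycle: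
  fixes a :: 'a
  assumes up: "upper (i, j)" and d: "distinct [i, j, k, l]"
  defines "e \<equiv> \<lambda>i. axis i (1::'a)"
  defines "f \<equiv> e i + (c * a) *s e k" and "g \<equiv> e j + e l"
  shows "volt c (e i) (e i) (e j) (e j) + volt c (e j) (e j) (e i) f + volt c (e i) f (e j) g
    + volt c (e j) g (e i) (e i) = single (i, j) a"
proof -
  have w: "wedge (e j) (e i) = wedge (e i) (e j)"
    by (simp add: fun_eq_iff wedge_plus ac_simps)
  have one: "pair (e i) (e i) = 1" "pair (e j) (e j) = 1" "pair f (e i) = 1" "pair g (e j) = 1"
    using d by (auto simp: e_def f_def g_def axis_index)
  have wP: "wedge (e i) (e j) p q = 0" if "upper (p, q)" "(p, q) \<noteq> (i, j)" for p q
    using that up by (auto simp: wedge_def e_def axis_index upper_def)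
  have wij: "wedge (e i) (e j) i j = 1" using d by (auto simp: wedge_def e_def axis_index)
  define \<Phi> where "\<Phi> p q = phi c (wedge (e i) (e j)) p q + phi c (wedge (e j) f) p q
    + phi c (wedge f g) p q + phi c (wedge g (e i)) p q" for p q
  have \<Phi>: "\<Phi> p q = (if (p, q) = (i, j) then a else 0)" if pq: "upper (p, q)" for p q
  proof -
    have "p \<noteq> q" using pq by (auto simp: upper_def)
    then obtain r s where rs: "distinct [p, q, r, s]" by (rule ex_distinct_4)
    have "\<Phi> p q = (wedge (e i) (e j) r s + wedge (e j) f r s + wedge f g r s + wedge g (e i) r s) / c"
      unfolding \<Phi>_def phi_entry[OF rs] by (simp add: add_divide_distrib)
    also have "wedge (e i) (e j) r s + wedge (e j) f r s + wedge f g r s + wedge g (e i) r s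
        = c * a * wedge (e k) (e l) r s"
      by (subst eq_iff_add_zero) (simp add: wedge_plus f_def g_def char2_simps)
    also have "wedge (e k) (e l) r s = (if (p, q) = (i, j) then 1 else 0)"
    proof -
      have "wedge (e k) (e l) r s = (if {r, s} = {k, l} then 1 else 0)"
        using d rs by (auto simp: wedge_plus e_def axis_index doubleton_eq_iff)
      moreover have "{r, s} = - {p, q}" "{k, l} = - {i, j}"
        using distinct_4_UNIV[OF rs] distinct_4_UNIV[OF d] rs d by auto
      then have "{r, s} = {k, l} \<longleftrightarrow> {p, q} = {i, j}" by simp
      moreover have "{p, q} = {i, j} \<longleftrightarrow> (p, q) = (i, j)"
        using pq up by (auto simp: doubleton_eq_iff upper_def)
      ultimately show ?thesis by simp
    qed
    finally show ?thesis using c_nz by simp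
  qed
  show ?thesis
  proof (intro ext)
    fix P Q :: "4 \<times> 4"
    obtain p q r s where PQ: "P = (p, q)" "Q = (r, s)" by force
    show "(volt c (e i) (e i) (e j) (e j) + volt c (e j) (e j) (e i) f + volt c (e i) f (e j) g
      + volt c (e j) g (e i) (e i)) P Q = single (i, j) a P Q"
    proof (cases "upper P \<and> upper Q")
      case False
      then show ?thesis using up by (auto simp: volt_def s2scale_def symprod_def single_def)
    next
      case True
      have "(volt c (e i) (e i) (e j) (e j) + volt c (e j) (e j) (e i) f + volt c (e i) f (e j) g
        + volt c (e j) g (e i) (e i)) P Q
        = (if P = Q then wedge (e i) (e j) p q * \<Phi> p q
           else wedge (e i) (e j) p q * \<Phi> r s + wedge (e i) (e j) r s * \<Phi> p q)"
        using True one by (simp add: volt_def s2scale_def symprod_def w \<Phi>_def PQ algebra_simps)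
      also have "\<dots> = single (i, j) a P Q"
        using True PQ wP[of p q] wP[of r s] wij \<Phi>[of p q] \<Phi>[of r s] by (auto simp: single_def)
      finally show ?thesis .
    qed
  qed
qed

section \<open>The lift over \<open>H\<^sub>3\<close>\<close>

lemma H3_vertsE:
  assumes "a \<in> (H3_verts :: (('a ^ 4) set \<times> ('a ^ 4) set) set)"
  obtains v f where "a = (pt v, pl f)" "pair f v = 1"
proof -
  obtain v f where a: "a = (pt v, pl f)" "pair f v \<noteq> 0" using assms unfolding H3_verts_alt by blast
  have "a = (pt (inverse (pair f v) *s v), pl f)" "pair f (inverse (pair f v) *s v) = 1"
    using a by (simp_all add: pt_scale)
  then show thesis using that by blast
qed

text \<open>The normalisation \<open>f(v) = 1\<close> is the one under which
  \<open>volt_potential\<close> holds; unlike the voltage, the potential changes when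
  \<open>v\<close> and \<open>f\<close> are scaled independently.\<close>

definition hrep :: "('a ^ 4) set \<times> ('a ^ 4) set \<Rightarrow> ('a ^ 4) \<times> ('a ^ 4)" where
  "hrep a = (SOME vf. a = (pt (fst vf), pl (snd vf)) \<and> pair (snd vf) (fst vf) = 1)"

lemma hrep:
  assumes "a \<in> H3_verts"
  shows "a = (pt (fst (hrep a)), pl (snd (hrep a)))" "pair (snd (hrep a)) (fst (hrep a)) = 1"
proof -
  have "\<exists>vf. a = (pt (fst vf), pl (snd vf)) \<and> pair (snd vf) (fst vf) = 1"
    using assms by (rule H3_vertsE) auto
  from someI_ex[OF this]
  show "a = (pt (fst (hrep a)), pl (snd (hrep a)))" "pair (snd (hrep a)) (fst (hrep a)) = 1"
    by (simp_all add: hrep_def)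
qed

definition vol :: "('a ^ 4) set \<times> ('a ^ 4) set \<Rightarrow> ('a ^ 4) set \<times> ('a ^ 4) set \<Rightarrow> 4 \<times> 4 \<Rightarrow> 4 \<times> 4 \<Rightarrow> 'a" where
  "vol a b = volt c (fst (hrep a)) (snd (hrep a)) (fst (hrep b)) (snd (hrep b))"

lemma hrep_scale:
  assumes "pair f v \<noteq> 0"
  obtains a b where "a \<noteq> 0" "b \<noteq> 0" "hrep (pt v, pl f) = (a *s v, b *s f)"
proof -
  have mem: "(pt v, pl f) \<in> H3_verts" using assms unfolding H3_verts_alt by blast
  obtain v' f' where r: "hrep (pt v, pl f) = (v', f')" by force
  have e: "pt v' = pt v" "pl f = pl f'" "pair f' v' = 1" using hrep[OF mem] r by auto
  have "v' \<noteq> 0" using e(3) by auto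
  then obtain a where "a \<noteq> 0" "v' = a *s v" using pt_eqD[OF e(1)] by blast
  moreover obtain b where "b \<noteq> 0" "f' = b *s f" using pl_eqD[OF e(2) assms] by blast
  ultimately show thesis using that r by blast
qed

lemma vol_eq:
  assumes "pair f v \<noteq> 0" "pair g w \<noteq> 0"
  shows "vol (pt v, pl f) (pt w, pl g) = volt c v f w g"
proof -
  obtain a b where ab: "a \<noteq> 0" "b \<noteq> 0" "hrep (pt v, pl f) = (a *s v, b *s f)"
    by (rule hrep_scale[OF assms(1)])
  obtain a' b' where ab': "a' \<noteq> 0" "b' \<noteq> 0" "hrep (pt w, pl g) = (a' *s w, b' *s g)"
    by (rule hrep_scale[OF assms(2)])
  show ?thesis using ab ab' by (simp add: vol_def volt_scale)
qed

lemma ell_eq_vol: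
  assumes "T \<in> Ht_verts" "S \<in> Ht_verts"
  shows "ell c T S = vol (proj T) (proj S)"
proof -
  have "pair (snd (rep T)) (fst (rep T)) \<noteq> 0" if T: "T \<in> Ht_verts" for T :: "4 \<Rightarrow> 4 \<Rightarrow> 'a"
  proof -
    obtain v f where T: "T = tensor v f" "pair f v \<noteq> 0" using T by (auto simp: Ht_verts_def)
    obtain a where "a \<noteq> 0" "rep T = (a *s v, inverse a *s f)" using rep_tensor[OF T(2)] T(1) by blast
    then show ?thesis using T(2) by simp
  qed
  then show ?thesis using assms by (simp add: ell_def proj_def vol_eq)
qed

section \<open>Classes modulo \<open>U\<close> and the lift over point-plane pairs\<close>

lemma cls_eq: "cls c x = {x, x + U0}"
  by (auto simp: cls_def HU_def UU_eq s2add_plus s2zero_zero)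

lemma cls_eq_iff: "cls c x = cls c y \<longleftrightarrow> x - y \<in> {0, U0}"
proof
  assume "cls c x = cls c y"
  then have "x = y \<or> x = y + U0" by (auto simp: cls_eq)
  then show "x - y \<in> {0, U0}" by auto
next
  assume "x - y \<in> {0, U0}"
  then have "x = y \<or> x = y + U0" by (auto simp: algebra_simps)
  then show "cls c x = cls c y"
    using s2_add_self[of U0] by (auto simp: cls_eq add.assoc)
qed

text \<open>In characteristic 2 \<open>U0\<close> is its own negative, so the four differences of
  representatives form a single class.\<close>

lemma qsub_cls: "qsub (cls c x) (cls c y) = cls c (x - y)"
proof -
  have "qsub (cls c x) (cls c y) = {x - y, x - (y + U0), x + U0 - y, x + U0 - (y + U0)}"
    by (auto simp: qsub_def s2sub_minus cls_eq)
  moreover have "x - (y + U0) = x - y + U0"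
    by (simp only: s2_diff_plus add.assoc)
  moreover have "x + U0 - y = x - y + U0" "x + U0 - (y + U0) = x - y" by (simp_all add: algebra_simps)
  ultimately show ?thesis by (simp add: cls_eq insert_commute)
qed

definition hadj :: "(('a ^ 4) set \<times> ('a ^ 4) set) \<times> (4 \<times> 4 \<Rightarrow> 4 \<times> 4 \<Rightarrow> 'a) set
    \<Rightarrow> (('a ^ 4) set \<times> ('a ^ 4) set) \<times> (4 \<times> 4 \<Rightarrow> 4 \<times> 4 \<Rightarrow> 'a) set \<Rightarrow> bool" where
  "hadj p r \<longleftrightarrow> H3_adj (fst p) (fst r) \<and> cls c (vol (fst p) (fst r)) = qsub (snd p) (snd r)"

lemma S2set_diff: "x \<in> S2set \<Longrightarrow> y \<in> S2set \<Longrightarrow> x - y \<in> (S2set :: (4 \<times> 4 \<Rightarrow> 4 \<times> 4 \<Rightarrow> 'a) set)"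
  unfolding S2set_def mem_Collect_eq by (metis (no_types, lifting) minus_apply diff_zero)

sublocale lift: voltage_lift H3_verts H3_adj vol S2set "{0, U0}" "cls c" hadj
proof
  show "connected_graph H3_verts (H3_adj :: ('a ^ 4) set \<times> ('a ^ 4) set \<Rightarrow> _)" by (rule H3_connected)
  show "H3_adj b a" if "H3_adj a b" for a b :: "('a ^ 4) set \<times> ('a ^ 4) set"
    using that by (rule H3_adj_sym)
  show "(0 :: 4 \<times> 4 \<Rightarrow> 4 \<times> 4 \<Rightarrow> 'a) \<in> S2set" by (simp add: S2set_def)
  then show "{0, U0} \<subseteq> S2set" using U0_S2set by simp
  show "x - y \<in> {0, U0}" if "x \<in> {0, U0}" "y \<in> {0, U0}" for x y
    using that by (auto simp: s2_minus_self)
  show "vol b a = - vol a b" for a b unfolding vol_def by (rule volt_skew)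
  show "vol a b \<in> S2set" for a b unfolding vol_def by (rule volt_S2set)
  show "hadj (a, cls c x) (b, cls c y) \<longleftrightarrow> H3_adj a b \<and> cls c (vol a b) = cls c (x - y)" for a b x y
    by (simp add: hadj_def qsub_cls)
  fix a b d :: "('a ^ 4) set \<times> ('a ^ 4) set"
  assume "a \<in> H3_verts" "b \<in> H3_verts" "d \<in> H3_verts" and adj: "H3_adj a b" "H3_adj b d" "H3_adj d a"
  then obtain v1 f1 v2 f2 v3 f3 where r: "a = (pt v1, pl f1)" "pair f1 v1 = 1"
    "b = (pt v2, pl f2)" "pair f2 v2 = 1" "d = (pt v3, pl f3)" "pair f3 v3 = 1"
    by (metis H3_vertsE)
  then have "vol a b + vol b d + vol d a = U0"
    using adj by (simp add: vol_eq H3_adj_iff volt_triangle)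
  then show "vol a b + vol b d + vol d a \<in> {0, U0}" by simp
qed (simp_all add: S2set_diff cls_eq_iff)

text \<open>The span of the squares: squaring is additive in characteristic 2, so squares have no
  mixed coefficients, and the six squares of basis bivectors form a basis.\<close>

definition squares :: "(4 \<times> 4 \<Rightarrow> 4 \<times> 4 \<Rightarrow> 'a) set" where
  "squares = {s \<in> S2set. \<forall>P Q. P \<noteq> Q \<longrightarrow> s P Q = 0}"

lemma squares_eq:
  assumes "s \<in> squares"
  shows "(\<lambda>P Q. if P = Q \<and> upper P then s P P else 0) = s"
proof (intro ext)
  fix P Q :: "4 \<times> 4"
  have "s P Q = 0" if "P \<noteq> Q \<or> \<not> upper P"
    using assms that unfolding squares_def S2set_def by blast
  then show "(if P = Q \<and> upper P then s P P else 0) = s P Q" by auto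
qed

lemma single_loops:
  assumes "upper R"
  shows "single R a \<in> lift.loops"
proof -
  obtain i j where R: "R = (i, j)" by force
  have "i \<noteq> j" using assms R by (auto simp: upper_def)
  then obtain k l where d: "distinct [i, j, k, l]" by (rule ex_distinct_4)
  define e :: "4 \<Rightarrow> 'a ^ 4" where "e i = axis i 1" for i
  define f g where "f = e i + (c * a) *s e k" and "g = e j + e l"
  have one: "pair (e i) (e i) = 1" "pair (e j) (e j) = 1" "pair f (e i) = 1" "pair g (e j) = 1"
    and zero: "pair (e i) (e j) = 0" "pair (e j) (e i) = 0" "pair f (e j) = 0" "pair g (e i) = 0"
    using d by (auto simp: e_def f_def g_def axis_index)
  have mem: "(pt (e i), pl (e i)) \<in> H3_verts" "(pt (e j), pl (e j)) \<in> H3_verts"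
    "(pt (e i), pl f) \<in> H3_verts" "(pt (e j), pl g) \<in> H3_verts"
    using one zero_neq_one unfolding H3_verts_alt by (metis (mono_tags, lifting) mem_Collect_eq)+
  have loop: "- (vol (pt (e i), pl (e i)) (pt (e j), pl (e j)) + vol (pt (e j), pl (e j)) (pt (e i), pl f)
      + vol (pt (e i), pl f) (pt (e j), pl g) + vol (pt (e j), pl g) (pt (e i), pl (e i))) \<in> lift.loops"
    by (rule lift.loops_four_cycle) (simp_all add: mem H3_adj_iff zero)
  show ?thesis
    using loop volt_four_cycle[OF assms[unfolded R] d, of a, folded e_def, folded f_def g_def]
    by (simp add: vol_eq one s2_minus_self R)
qed

lemma squares_loops: "squares \<subseteq> lift.loops"
proof
  fix s assume s: "s \<in> squares"
  have "(\<lambda>P Q. if P = Q \<and> P \<in> A then s P P else 0) \<in> lift.loops"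
    if "finite A" "A \<subseteq> Collect upper" for A
    using that
  proof (induction rule: finite_induct)
    case empty
    then show ?case using lift.loops_zero by (simp add: zero_fun_def)
  next
    case (insert R A)
    have sum: "single R (s R R) + (\<lambda>P Q. if P = Q \<and> P \<in> A then s P P else 0) \<in> lift.loops"
      using insert by (intro lift.loops_add single_loops) auto
    have "single R (s R R) + (\<lambda>P Q. if P = Q \<and> P \<in> A then s P P else 0)
        = (\<lambda>P Q. if P = Q \<and> P \<in> insert R A then s P P else 0)"
      using insert(2) by (auto simp: fun_eq_iff single_def)
    with sum show ?case by simp
  qed
  from this[of "Collect upper"]
  have "(\<lambda>P Q. if P = Q \<and> upper P then s P P else 0) \<in> lift.loops" by simp
  then show "s \<in> lift.loops" using squares_eq[OF s] by simp
qed

lemma squares_eqpoll: "squares \<approx> (UNIV :: ('a ^ 6) set)"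
proof -
  have "Collect upper = {(0, 1), (0, 2), (0, 3), (1, 2), (1, 3), (2, 3)}"
    using upper_iff by blast
  then have "card (Collect upper) = card (UNIV :: 6 set)" by simp
  then obtain h :: "6 \<Rightarrow> 4 \<times> 4" where h: "bij_betw h UNIV (Collect upper)"
    using finite_same_card_bij[of "UNIV :: 6 set" "Collect upper"] by auto
  have up: "upper (h n)" for n using h by (auto simp: bij_betw_def)
  have "bij_betw (\<lambda>s. \<chi> n. s (h n) (h n)) squares (UNIV :: ('a ^ 6) set)"
  proof (rule bij_betw_byWitness[where f' = "\<lambda>x P Q. if P = Q \<and> upper P then x $ inv h P else 0"])
    have inv: "inv h (h n) = n" for n using h by (simp add: bij_betw_def inv_f_f)
    have inv': "h (inv h P) = P" if "upper P" for P
      using h that by (auto simp: bij_betw_def intro!: f_inv_into_f)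
    show "\<forall>s\<in>squares. (\<lambda>P Q. if P = Q \<and> upper P then (\<chi> n. s (h n) (h n)) $ inv h P else 0) = s"
      using squares_eq by (auto simp: inv' cong: if_cong conj_cong)
    show "\<forall>x\<in>UNIV. (\<chi> n. (if h n = h n \<and> upper (h n) then x $ inv h (h n) else 0)) = (x :: 'a ^ 6)"
      by (simp add: up inv vec_eq_iff)
    show "(\<lambda>x P Q. if P = Q \<and> upper P then (x :: 'a ^ 6) $ inv h P else 0) ` UNIV \<subseteq> squares"
      by (auto simp: squares_def S2set_def)
  qed simp
  then show ?thesis by (auto simp: eqpoll_def)
qed

lemma pot_S2set: "pot v f \<in> S2set"
proof -
  have zero: "pot v f P Q = 0" if "\<not> (upper P \<and> upper Q)" for P Q
    using that by (auto simp: pot_def)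
  have sym: "pot v f P Q = pot v f Q P" for P Q
  proof (cases "upper P \<and> upper Q \<and> distinct [fst P, snd P, fst Q, snd Q]")
    case True
    \<comment> \<open>Both orders of a complementary pair select the member that contains 0, so
      \<open>pot\<close> is symmetric there.\<close>
    then have "fst P = 0 \<and> fst Q \<noteq> 0 \<or> fst P \<noteq> 0 \<and> fst Q = 0"
      by (elim conjE upper_cases[of P] upper_cases[of Q]) simp_all
    then show ?thesis using True by (auto simp: pot_def)
  next
    case False
    have "{fst P, snd P} \<inter> {fst Q, snd Q} = {fst Q, snd Q} \<inter> {fst P, snd P}"
      "{fst P, snd P, fst Q, snd Q} = {fst Q, snd Q, fst P, snd P}" by auto
    note sets = this
    show ?thesis
    proof (cases "upper P \<and> upper Q \<and> P \<noteq> Q")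
      case True
      then have "\<not> distinct [fst P, snd P, fst Q, snd Q]" "\<not> distinct [fst Q, snd Q, fst P, snd P]"
        using False by auto
      with True show ?thesis unfolding pot_def by (simp only: sets if_False if_True simp_thms not_sym)
    next
      case False
      then show ?thesis by (auto simp: pot_def)
    qed
  qed
  show ?thesis unfolding S2set_def using zero sym by blast
qed

lemma vol_potential:
  assumes "a \<in> H3_verts" "b \<in> H3_verts" "H3_adj a b"
  shows "vol a b - (pot (fst (hrep a)) (snd (hrep a)) - pot (fst (hrep b)) (snd (hrep b))) - U0 \<in> squares"
proof -
  have "H3_adj (pt (fst (hrep a)), pl (snd (hrep a))) (pt (fst (hrep b)), pl (snd (hrep b)))"
    using assms hrep(1) by metis
  then have eq: "vol a b P Q = pot (fst (hrep a)) (snd (hrep a)) P Q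
      + pot (fst (hrep b)) (snd (hrep b)) P Q + U0 P Q" if "P \<noteq> Q" for P Q
    unfolding vol_def H3_adj_iff
    using hrep(2)[OF assms(1)] hrep(2)[OF assms(2)] that by (intro volt_potential) auto
  then show ?thesis
    unfolding squares_def
  proof (intro CollectI conjI allI impI)
    fix P Q :: "4 \<times> 4" assume "P \<noteq> Q"
    then show "(vol a b - (pot (fst (hrep a)) (snd (hrep a)) - pot (fst (hrep b)) (snd (hrep b))) - U0) P Q = 0"
      using eq[of P Q] by (simp add: char2_simps)
  qed (intro S2set_diff pot_S2set U0_S2set volt_S2set[folded vol_def], unfold vol_def, rule volt_S2set)
qed

lemma lift_component_cover:
  assumes "u \<in> H3_verts \<times> cls c ` S2set"
  shows "k_fold_cover (component (H3_verts \<times> cls c ` S2set) hadj u) hadj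
    (H3_verts :: (('a ^ 4) set \<times> ('a ^ 4) set) set) H3_adj (UNIV :: ('a ^ 6) set)"
proof (rule lift.component_cover[where Q = squares and pot = "\<lambda>a. pot (fst (hrep a)) (snd (hrep a))"])
  have diff: "x - y \<in> squares" if "x \<in> squares" "y \<in> squares" for x y
    using that by (auto simp: squares_def S2set_diff)
  then show "x - y \<in> squares" if "x \<in> squares" "y \<in> squares" for x y using that .
  show "x + y \<in> squares" if "x \<in> squares" "y \<in> squares" for x y
    using diff[OF that] by (simp add: s2_diff_plus)
  show zero: "0 \<in> squares" by (simp add: squares_def S2set_def)
  \<comment> \<open>A mixed coefficient separates \<open>U0\<close> from the span of the
    squares.\<close>
  have "U0 (0, 1) (2, 3) \<noteq> 0" using c_nz by (simp add: U0_def upper_iff)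
  moreover have "s (0, 1) (2, 3) = 0" if "s \<in> squares" for s
    using that by (simp add: squares_def)
  ultimately have "U0 \<notin> squares" by blast
  then show "squares \<inter> {0, U0} = {0}" using zero by auto
  show "\<exists>q\<in>squares. \<exists>k\<in>{0, U0}. vol a b
      - (pot (fst (hrep a)) (snd (hrep a)) - pot (fst (hrep b)) (snd (hrep b))) = q + k"
    if "a \<in> H3_verts" "b \<in> H3_verts" "H3_adj a b" for a b
    by (rule bexI[OF _ vol_potential[OF that]], rule bexI[of _ U0]) simp_all
qed (rule squares_loops squares_eqpoll assms)+

end

section \<open>Identification of the reduct and conclusion\<close>

theorem theorem3p6:
  fixes c :: "'a::field"
  assumes "CHAR('a) = 2"
    and "c \<noteq> 0"
  shows "\<forall>u \<in> Gverts c.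
           k_fold_cover (component (Gverts c) (Gadj c) u) (Gadj c)
                        (H3_verts :: (('a ^ 4) set \<times> ('a ^ 4) set) set) H3_adj
                        (UNIV :: ('a ^ 6) set)"
proof
  interpret char2_field c using assms by unfold_locales
  fix u assume u: "u \<in> Gverts c"
  \<comment> \<open>\<open>q\<close> keeps only the point and the plane of a tensor. Adjacency and
    voltage depend on nothing else, so \<open>reduct_iso\<close> identifies the reduct with
    \<open>W\<close>.\<close>
  define q where "q = (\<lambda>(T, N). (proj T, N) :: (('a ^ 4) set \<times> ('a ^ 4) set) \<times> (4 \<times> 4 \<Rightarrow> 4 \<times> 4 \<Rightarrow> 'a) set)"
  define W where "W = (H3_verts :: (('a ^ 4) set \<times> ('a ^ 4) set) set) \<times> cls c ` S2set"
  have img: "q ` Lverts c = W"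
    unfolding q_def W_def Lverts_def Nq_def proj_Ht_verts[symmetric] by force
  have q_adj: "Ladj c x y \<longleftrightarrow> hadj (q x) (q y)" if "x \<in> Lverts c" "y \<in> Lverts c" for x y
    using that by (auto simp: Lverts_def Ladj_def hadj_def q_def ellU_def Ht_adj_iff ell_eq_vol)
  have inj: "inj_on (nbhd W hadj) W"
    unfolding W_def by (rule lift.nbhd_inj[OF H3_nbhd_inj H3_nbhd_nonempty])
  obtain \<phi> where bij: "bij_betw \<phi> (Gverts c) W"
    and adj': "\<forall>A\<in>Gverts c. \<forall>B\<in>Gverts c. Gadj c A B \<longleftrightarrow> hadj (\<phi> A) (\<phi> B)"
    using reduct_iso[OF img q_adj inj] unfolding Gverts_def Gadj_def by blast
  then have adj: "Gadj c A B \<longleftrightarrow> hadj (\<phi> A) (\<phi> B)" if "A \<in> Gverts c" "B \<in> Gverts c" for A B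
    using that by blast
  have "\<phi> u \<in> W" using bij u by (auto simp: bij_betw_def)
  then have cover: "k_fold_cover (component W hadj (\<phi> u)) hadj
      (H3_verts :: (('a ^ 4) set \<times> ('a ^ 4) set) set) H3_adj (UNIV :: ('a ^ 6) set)"
    unfolding W_def by (rule lift_component_cover)
  have bij': "bij_betw \<phi> (component (Gverts c) (Gadj c) u) (component W hadj (\<phi> u))"
    using bij adj u by (rule bij_betw_component)
  show "k_fold_cover (component (Gverts c) (Gadj c) u) (Gadj c)
          (H3_verts :: (('a ^ 4) set \<times> ('a ^ 4) set) set) H3_adj (UNIV :: ('a ^ 6) set)"
    by (rule k_fold_cover_iso[OF bij' _ cover]) (auto simp: component_def adj)
qed

end
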